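(* Let $q\ge 2$ be a prime integer, let $0<i<d-1$, let $\beta\ge 0$, and let $\gamma\in Z_{i-1}(\mathbb{Z}^d;\mathbb{F}_q)$ be an $(i-1)$-cycle in $\mathbb{Z}^d$. Then $$\mathbb{E}_{\nu^{\mathbf f}}(W_\gamma)=\mu_{\mathbb{Z}^d}(V_\gamma),$$ where $\nu^{\mathbf f}$ is the infinite-volume $(i-1)$-dimensional $q$-state Potts lattice gauge theory on $\mathbb{Z}^d$ at inverse temperature $\beta$ with free boundary conditions, and $\mu_{\mathbb{Z}^d}$ is the infinite-volume $i$-dimensional plaquette random-cluster model on $\mathbb{Z}^d$ with free boundary conditions, with parameters $p=1-e^{-\beta}$ and $q$ and coefficient field $\mathbb{F}_q$.
   Context: $\mathbb{Z}^d$ denotes the cubical complex consisting of all unit $j$-dimensional cubes ($j$-plaquettes), $0\le j\le d$, with corners in the integer lattice. Chains, cycles, boundaries, cochains and (co)homology are cellular; chains are finite linear combinations. $\delta f(\sigma)=f(\partial\sigma)$ is the coboundary. Plaquette random-cluster model: for a finite cubical complex $X$, a field $\mathbb{F}$, $p\in[0,1]$, $q>0$, the $i$-dimensional plaquette random-cluster model on $X$ is the random $i$-complex $P\subset X$ containing the full $(i-1)$-skeleton of $X$ (and no cells of dimension $>i$) with $$\mu_{X,p,q,i,\mathbb{F}}(P)=\frac1Z p^{|P|}(1-p)^{|X^i|-|P|}q^{\mathbf b_{i-1}(P;\mathbb{F})},$$ where $|X^i|$ and $|P|$ are the numbers of $i$-cells of $X$ and $P$, $\mathbf b_{i-1}(P;\mathbb{F})=\dim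 H_{i-1}(P;\mathbb{F})$, and $Z$ is a normalizing constant. Potts lattice gauge theory: for a finite cubical complex $X$, prime $q$ and $\beta\ge0$, $(i-1)$-dimensional $q$-state Potts lattice gauge theory is the probability measure on $C^{i-1}(X;\mathbb{F}_q)$ given by $\nu(f)=\frac1{\mathcal Z}e^{-\beta H(f)}$ with $H(f)=-\sum_{\sigma\in X^i}K(\delta f(\sigma),0)$, where $K$ is the Kronecker delta and $X^i$ is the set of $i$-cells. Infinite volume, free boundary conditions: let $\Lambda_n=[-n,n]^d\cap\mathbb{Z}^d$, regarded as the finite subcomplex of all plaquettes with all vertices in $\Lambda_n$. $\mu_{\mathbb{Z}^d}$ (free) and $\nu^{\mathbf f}$ are the weak limits as $n\to\infty$ of the corresponding measures on $\Lambda_n$ (these limits exist). $V_\gamma$ is the event that $\gamma$ is null-homologous in $P$, i.e. $\gamma=\partial\rho$ for some $\rho\in C_i(P;\mathbb{F}_q)$. The generalized Wilson loop variable is $W_\gamma(f)=(f(\gamma))^{\mathbb{C}}$, where for $g\in\mathbb{F}_q$, $g^{\mathbb{C}}=e^{2\pi\mathrm{i}g/q}\in\mathbb{C}$ is the corresponding $q$-th root of unity. *)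

theory Defs
  imports
    "HOL-Probability.Probability"
    "Jordan_Normal_Form.VS_Connect"
    "Berlekamp_Zassenhaus.Finite_Field"
begin

section \<open>The cubical complex of the integer lattice\<close>

text \<open>
  A plaquette is a product of elementary intervals, one for each coordinate:
  \<open>Pt a\<close> is the degenerate interval \<open>{a}\<close> and \<open>Edge a\<close> is the unit interval \<open>[a, a + 1]\<close>.
\<close>

datatype interval = Pt int | Edge int

instance interval :: countable
  by countable_datatype

type_synonym cube = "interval list"

fun endpoints :: "interval \<Rightarrow> int set" where
  "endpoints (Pt a) = {a}"
| "endpoints (Edge a) = {a, a + 1}"

definition is_edge :: "interval \<Rightarrow> bool" where
  "is_edge I \<longleftrightarrow> (\<exists>a. I = Edge a)"

definition cube_dim :: "cube \<Rightarrow> nat" where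
  "cube_dim \<sigma> = length (filter is_edge \<sigma>)"

definition cells :: "nat \<Rightarrow> cube set \<Rightarrow> cube set" where
  "cells j X = {\<sigma> \<in> X. cube_dim \<sigma> = j}"

definition lattice_complex :: "nat \<Rightarrow> cube set" where
  "lattice_complex d = {\<sigma>. length \<sigma> = d}"

text \<open>The vertices of a plaquette are the products of endpoints of its factors, so all of them
  lie in \<open>[-n, n]^d\<close> iff all endpoints of all factors lie in \<open>[-n, n]\<close>.\<close>

definition box :: "nat \<Rightarrow> nat \<Rightarrow> cube set" where
  "box d n = {\<sigma> \<in> lattice_complex d. \<forall>I \<in> set \<sigma>. endpoints I \<subseteq> {- int n .. int n}}"

lemma finite_box: "finite (box d n)"
proof -
  let ?B = "{- int n .. int n}"
  have "box d n \<subseteq> {\<sigma>. set \<sigma> \<subseteq> Pt ` ?B \<union> Edge ` ?B \<and> length \<sigma> = d}"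
  proof
    fix \<sigma> assume s: "\<sigma> \<in> box d n"
    have "I \<in> Pt ` ?B \<union> Edge ` ?B" if "I \<in> set \<sigma>" for I
      using s that by (cases I) (auto simp: box_def)
    then show "\<sigma> \<in> {\<sigma>. set \<sigma> \<subseteq> Pt ` ?B \<union> Edge ` ?B \<and> length \<sigma> = d}"
      using s by (auto simp: box_def lattice_complex_def)
  qed
  moreover have "finite \<dots>" by (rule finite_lists_length_eq) auto
  ultimately show ?thesis by (rule finite_subset)
qed


section \<open>Cellular chains, cochains and homology\<close>

text \<open>A chain is its coefficient function; \<open>cell_chains j X\<close> consists of the finitely supported ones.\<close>

type_synonym 'k chain = "cube \<Rightarrow> 'k"

definition cell_chains :: "nat \<Rightarrow> cube set \<Rightarrow> ('k::field) chain set" where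
  "cell_chains j X = {c. finite {\<sigma>. c \<sigma> \<noteq> 0} \<and> {\<sigma>. c \<sigma> \<noteq> 0} \<subseteq> cells j X}"

text \<open>
  With \<open>\<partial>[a, a + 1] = {a + 1} - {a}\<close>, the signs are those of the product formula
  \<open>\<partial>(I \<times> \<sigma>) = \<partial>I \<times> \<sigma> + (-1)^(dim I) (I \<times> \<partial>\<sigma>)\<close>.
\<close>

definition cube_boundary :: "cube \<Rightarrow> ('k::field) chain" where
  "cube_boundary \<sigma> \<tau> = (\<Sum>k<length \<sigma>. case \<sigma> ! k of
      Pt a \<Rightarrow> 0
    | Edge a \<Rightarrow> (-1) ^ cube_dim (take k \<sigma>) *
        (of_bool (\<tau> = \<sigma>[k := Pt (a + 1)]) - of_bool (\<tau> = \<sigma>[k := Pt a])))"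

definition boundary :: "('k::field) chain \<Rightarrow> 'k chain" where
  "boundary c = (\<lambda>\<tau>. \<Sum>\<sigma> | c \<sigma> \<noteq> 0. c \<sigma> * cube_boundary \<sigma> \<tau>)"

lemma boundary_superset:
  assumes "finite A" "{\<sigma>. c \<sigma> \<noteq> 0} \<subseteq> A"
  shows "boundary c \<tau> = (\<Sum>\<sigma>\<in>A. c \<sigma> * cube_boundary \<sigma> \<tau>)"
  unfolding boundary_def using assms by (intro sum.mono_neutral_left) auto

lemma cube_boundary_Nil [simp]: "cube_boundary [] \<tau> = 0"
  by (simp add: cube_boundary_def)

lemma cube_boundary_Cons:
  "cube_boundary (I # \<sigma>) \<tau> =
     (case I of Pt a \<Rightarrow> 0 | Edge a \<Rightarrow> of_bool (\<tau> = Pt (a + 1) # \<sigma>) - of_bool (\<tau> = Pt a # \<sigma>)) +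
     (case \<tau> of [] \<Rightarrow> 0 | J # \<tau>' \<Rightarrow> of_bool (J = I) * (-1) ^ cube_dim [I] * cube_boundary \<sigma> \<tau>')"
proof -
  let ?g = "\<lambda>k. case \<sigma> ! k of Pt a \<Rightarrow> 0 | Edge a \<Rightarrow> (-1) ^ cube_dim (I # take k \<sigma>) *
        (of_bool (\<tau> = I # \<sigma>[k := Pt (a + 1)]) - of_bool (\<tau> = I # \<sigma>[k := Pt a]))"
  have "cube_boundary (I # \<sigma>) \<tau> =
     (case I of Pt a \<Rightarrow> 0 | Edge a \<Rightarrow> of_bool (\<tau> = Pt (a + 1) # \<sigma>) - of_bool (\<tau> = Pt a # \<sigma>)) +
     (\<Sum>k<length \<sigma>. ?g k)"
    unfolding cube_boundary_def length_Cons lessThan_Suc_atMost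
    by (subst sum.atMost_shift) (simp add: cube_dim_def cong: interval.case_cong sum.cong)
  also have "(\<Sum>k<length \<sigma>. ?g k) =
     (case \<tau> of [] \<Rightarrow> 0 | J # \<tau>' \<Rightarrow> of_bool (J = I) * (-1) ^ cube_dim [I] * cube_boundary \<sigma> \<tau>')"
    by (auto simp: cube_boundary_def cube_dim_def sum_distrib_left split: list.splits interval.splits
             intro!: sum.cong sum.neutral)
  finally show ?thesis .
qed

lemma finite_faces: "finite {\<tau>. cube_boundary \<sigma> \<tau> \<noteq> (0::'k::field)}"
proof (induction \<sigma>)
  case (Cons I \<sigma>)
  let ?S = "{\<tau>. cube_boundary \<sigma> \<tau> \<noteq> (0::'k)}"
  have "\<tau> \<in> (case I of Pt a \<Rightarrow> {} | Edge a \<Rightarrow> {Pt (a + 1) # \<sigma>, Pt a # \<sigma>}) \<union> Cons I ` ?S"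
    if "cube_boundary (I # \<sigma>) \<tau> \<noteq> (0::'k)" for \<tau>
    using that by (cases \<tau>; cases I) (auto simp: cube_boundary_Cons of_bool_def split: if_splits)
  then have "{\<tau>. cube_boundary (I # \<sigma>) \<tau> \<noteq> (0::'k)} \<subseteq>
      (case I of Pt a \<Rightarrow> {} | Edge a \<Rightarrow> {Pt (a + 1) # \<sigma>, Pt a # \<sigma>}) \<union> Cons I ` ?S" by blast
  moreover have "finite \<dots>"
    using Cons by (auto split: interval.splits)
  ultimately show ?case by (rule finite_subset)
qed auto

lemma boundary_cube_boundary: "boundary (cube_boundary \<sigma> :: 'k::field chain) = (\<lambda>_. 0)"
proof (induction \<sigma>)
  case Nil
  show ?case by (simp add: boundary_def)
next
  case (Cons I \<sigma>)
  define S where "S = insert \<sigma> {\<tau>. cube_boundary \<sigma> \<tau> \<noteq> (0::'k)}"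
  define K where "K = (case I of Pt a \<Rightarrow> {I} | Edge a \<Rightarrow> {I, Pt (a + 1), Pt a})"
  have fin: "finite S" "finite K"
    by (auto simp: S_def K_def finite_faces split: interval.splits)
  have "\<tau> \<in> case_prod Cons ` (K \<times> S)" if "cube_boundary (I # \<sigma>) \<tau> \<noteq> (0::'k)" for \<tau>
  proof (cases \<tau>)
    case (Cons J \<tau>')
    have "J \<in> K \<and> \<tau>' \<in> S" using that unfolding Cons S_def K_def
      by (cases I) (auto simp: cube_boundary_Cons of_bool_def split: if_splits)
    then show ?thesis using Cons by force
  qed (use that in \<open>cases I, auto simp: cube_boundary_Cons\<close>)
  then have supp: "{\<tau>. cube_boundary (I # \<sigma>) \<tau> \<noteq> (0::'k)} \<subseteq> case_prod Cons ` (K \<times> S)"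
    by blast
  have IH: "(\<Sum>\<tau>\<in>S. cube_boundary \<sigma> \<tau> * cube_boundary \<tau> \<rho>) = (0::'k)" for \<rho>
  proof -
    have "boundary (cube_boundary \<sigma> :: 'k chain) \<rho> = (\<Sum>\<tau>\<in>S. cube_boundary \<sigma> \<tau> * cube_boundary \<tau> \<rho>)"
      using fin by (intro boundary_superset) (auto simp: S_def)
    then show ?thesis using Cons by simp
  qed
  show ?case
  proof
    fix \<rho>
    have "boundary (cube_boundary (I # \<sigma>) :: 'k chain) \<rho> =
       (\<Sum>\<tau>\<in>case_prod Cons ` (K \<times> S). cube_boundary (I # \<sigma>) \<tau> * cube_boundary \<tau> \<rho>)"
      using fin supp by (intro boundary_superset) auto
    also have "\<dots> = (\<Sum>J\<in>K. \<Sum>\<tau>\<in>S. cube_boundary (I # \<sigma>) (J # \<tau>) * cube_boundary (J # \<tau>) \<rho>)"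
      by (subst sum.reindex) (auto simp: inj_on_def sum.cartesian_product case_prod_beta)
    also have "\<dots> = 0"
    proof (cases I)
      case (Pt a)
      show ?thesis
        using IH by (cases \<rho>) (auto simp: Pt K_def cube_boundary_Cons cube_dim_def is_edge_def)
    next
      case (Edge a)
      have s: "\<sigma> \<in> S" by (simp add: S_def)
      have d: "(\<Sum>\<tau>\<in>S. of_bool (\<tau> = \<sigma>) * h \<tau>) = (h \<sigma> :: 'k)" for h
        using s fin by (simp add: of_bool_def if_distrib[of "\<lambda>x. x * _"] sum.delta cong: if_cong)
      have d': "(\<Sum>\<tau>\<in>S. cube_boundary \<sigma> \<tau> * of_bool (\<rho>' = \<tau>)) = (cube_boundary \<sigma> \<rho>' :: 'k)" for \<rho>'
      proof (cases "\<rho>' \<in> S")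
        case True
        then show ?thesis using fin
          by (simp add: of_bool_def if_distrib[of "\<lambda>x. _ * x"] sum.delta' cong: if_cong)
      next
        case False
        then have "cube_boundary \<sigma> \<rho>' = (0::'k)" by (auto simp: S_def)
        then show ?thesis using False by (auto intro!: sum.neutral)
      qed
      have e1: "cube_boundary (I # \<sigma>) (I # \<tau>) = - (cube_boundary \<sigma> \<tau> :: 'k)" for \<tau>
        by (simp add: Edge cube_boundary_Cons cube_dim_def is_edge_def)
      have e2: "cube_boundary (I # \<sigma>) (Pt (a+1) # \<tau>) = (of_bool (\<tau> = \<sigma>) :: 'k)" for \<tau>
        by (simp add: Edge cube_boundary_Cons)
      have e3: "cube_boundary (I # \<sigma>) (Pt a # \<tau>) = (- of_bool (\<tau> = \<sigma>) :: 'k)" for \<tau>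
        by (simp add: Edge cube_boundary_Cons)
      show ?thesis
      proof (cases \<rho>)
        case Nil
        then show ?thesis by (simp add: cube_boundary_Cons Edge K_def)
      next
        case (Cons L \<rho>')
        have f1: "cube_boundary (I # \<tau>) \<rho> = ((of_bool (L = Pt (a+1)) - of_bool (L = Pt a)) * of_bool (\<rho>' = \<tau>)
             - of_bool (L = I) * cube_boundary \<tau> \<rho>' :: 'k)" for \<tau>
          by (auto simp add: Cons Edge cube_boundary_Cons cube_dim_def is_edge_def)
        have f2: "cube_boundary (Pt b # \<tau>) \<rho> = (of_bool (L = Pt b) * cube_boundary \<tau> \<rho>' :: 'k)" for b \<tau>
          by (simp add: Cons cube_boundary_Cons cube_dim_def is_edge_def)
        have "(\<Sum>J\<in>K. \<Sum>\<tau>\<in>S. cube_boundary (I # \<sigma>) (J # \<tau>) * cube_boundary (J # \<tau>) \<rho>) =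
           (\<Sum>\<tau>\<in>S. cube_boundary (I # \<sigma>) (I # \<tau>) * cube_boundary (I # \<tau>) \<rho>) +
           (\<Sum>\<tau>\<in>S. cube_boundary (I # \<sigma>) (Pt (a+1) # \<tau>) * cube_boundary (Pt (a+1) # \<tau>) \<rho>) +
           (\<Sum>\<tau>\<in>S. cube_boundary (I # \<sigma>) (Pt a # \<tau>) * (cube_boundary (Pt a # \<tau>) \<rho> :: 'k))"
          by (simp add: K_def Edge add_ac)
        also have "(\<Sum>\<tau>\<in>S. cube_boundary (I # \<sigma>) (I # \<tau>) * cube_boundary (I # \<tau>) \<rho>) =
            - (of_bool (L = Pt (a+1)) - of_bool (L = Pt a)) * (\<Sum>\<tau>\<in>S. cube_boundary \<sigma> \<tau> * of_bool (\<rho>' = \<tau>))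
            + of_bool (L = I) * (\<Sum>\<tau>\<in>S. cube_boundary \<sigma> \<tau> * (cube_boundary \<tau> \<rho>' :: 'k))"
          unfolding e1 f1 sum_distrib_left sum.distrib[symmetric]
          by (intro sum.cong refl) (simp add: algebra_simps)
        also have "(\<Sum>\<tau>\<in>S. cube_boundary (I # \<sigma>) (Pt (a+1) # \<tau>) * cube_boundary (Pt (a+1) # \<tau>) \<rho>) =
            of_bool (L = Pt (a+1)) * (cube_boundary \<sigma> \<rho>' :: 'k)" unfolding e2 f2 by (rule d)
        also have "(\<Sum>\<tau>\<in>S. cube_boundary (I # \<sigma>) (Pt a # \<tau>) * cube_boundary (Pt a # \<tau>) \<rho>) =
            - (of_bool (L = Pt a) * (cube_boundary \<sigma> \<rho>' :: 'k))"
          unfolding e3 f2 by (simp only: mult_minus_left sum_negf d)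
        finally show ?thesis unfolding IH d' by (simp add: algebra_simps)
      qed
    qed
    finally show "boundary (cube_boundary (I # \<sigma>) :: 'k chain) \<rho> = 0" .
  qed
qed

definition cycles :: "nat \<Rightarrow> cube set \<Rightarrow> ('k::field) chain set" where
  "cycles j X = {c \<in> cell_chains j X. boundary c = (\<lambda>_. 0)}"

definition boundaries :: "nat \<Rightarrow> cube set \<Rightarrow> ('k::field) chain set" where
  "boundaries j X = boundary ` cell_chains (Suc j) X"

definition homology_class :: "nat \<Rightarrow> cube set \<Rightarrow> ('k::field) chain \<Rightarrow> 'k chain set" where
  "homology_class j X z = {(\<lambda>\<sigma>. z \<sigma> + b \<sigma>) |b. b \<in> boundaries j X}"

text \<open>
  The quotient space of cycles by boundaries; a module record extends a ring record, whose
  multiplicative fields play no role. In the scalar multiplication, boundaries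
  are added so that also the multiple by 0 is a full coset.
\<close>

definition homology :: "nat \<Rightarrow> cube set \<Rightarrow> ('k::field, 'k chain set) module" where
  "homology j X = \<lparr>
     carrier = homology_class j X ` cycles j X,
     mult = undefined,
     one = undefined,
     zero = boundaries j X,
     add = (\<lambda>U V. {(\<lambda>\<sigma>. u \<sigma> + v \<sigma>) |u v. u \<in> U \<and> v \<in> V}),
     smult = (\<lambda>a U. {(\<lambda>\<sigma>. a * u \<sigma> + b \<sigma>) |u b. u \<in> U \<and> b \<in> boundaries j X}) \<rparr>"

lemma chains_comb:
  assumes "u \<in> cell_chains j X" "v \<in> cell_chains j X"
  shows "(\<lambda>\<sigma>. a * u \<sigma> + b * v \<sigma>) \<in> cell_chains j X"
proof -
  have "{\<sigma>. a * u \<sigma> + b * v \<sigma> \<noteq> 0} \<subseteq> {\<sigma>. u \<sigma> \<noteq> 0} \<union> {\<sigma>. v \<sigma> \<noteq> 0}" by auto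
  then show ?thesis using assms unfolding cell_chains_def
    by (auto intro: finite_subset)
qed

lemma boundary_comb:
  assumes "u \<in> cell_chains j X" "v \<in> cell_chains j X"
  shows "boundary (\<lambda>\<sigma>. a * u \<sigma> + b * v \<sigma>) = (\<lambda>\<tau>. a * boundary u \<tau> + b * boundary v \<tau>)"
proof
  fix \<tau>
  let ?A = "{\<sigma>. u \<sigma> \<noteq> 0} \<union> {\<sigma>. v \<sigma> \<noteq> 0}"
  have f: "finite ?A" using assms by (auto simp: cell_chains_def)
  show "boundary (\<lambda>\<sigma>. a * u \<sigma> + b * v \<sigma>) \<tau> = a * boundary u \<tau> + b * boundary v \<tau>"
    by (subst (1 2 3) boundary_superset[OF f])
       (auto simp: sum.distrib sum_distrib_left algebra_simps)
qed

lemma zero_chains: "(\<lambda>_. 0) \<in> cell_chains j X"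
  by (simp add: cell_chains_def)

lemma cycles_comb:
  assumes "u \<in> cycles j X" "v \<in> cycles j X"
  shows "(\<lambda>\<sigma>. a * u \<sigma> + b * v \<sigma>) \<in> cycles j X"
  using assms by (auto simp: cycles_def chains_comb boundary_comb)

lemma boundaries_comb:
  assumes "u \<in> boundaries j X" "v \<in> boundaries j X"
  shows "(\<lambda>\<sigma>. a * u \<sigma> + b * v \<sigma>) \<in> boundaries j X"
  using assms by (auto simp: boundaries_def simp flip: boundary_comb intro!: imageI chains_comb)

lemma zero_boundaries: "(\<lambda>_. 0) \<in> boundaries j X"
  unfolding boundaries_def by (rule image_eqI[OF _ zero_chains]) (simp add: boundary_def)

lemma zero_cycles: "(\<lambda>_. 0) \<in> cycles j X"
  by (simp add: cycles_def zero_chains boundary_def)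

lemmas boundaries_add = boundaries_comb[where a = 1 and b = 1, simplified]
lemmas boundaries_diff = boundaries_comb[where a = 1 and b = "-1", simplified]
lemmas boundaries_scale = boundaries_comb[OF _ zero_boundaries, simplified]
lemmas cycles_add = cycles_comb[where a = 1 and b = 1, simplified]
lemmas cycles_scale = cycles_comb[OF _ zero_cycles, simplified]

lemma mem_homology_class: "u \<in> homology_class j X z \<longleftrightarrow> (\<lambda>\<sigma>. u \<sigma> - z \<sigma>) \<in> boundaries j X"
  unfolding homology_class_def
  by (auto intro: exI[of _ "\<lambda>\<sigma>. u \<sigma> - z \<sigma>"])

lemma add_homology_class:
  "homology_class j X z \<oplus>\<^bsub>homology j X\<^esub> homology_class j X z' = homology_class j X (\<lambda>\<sigma>. z \<sigma> + z' \<sigma>)"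
proof (intro equalityI subsetI)
  fix x assume "x \<in> homology_class j X z \<oplus>\<^bsub>homology j X\<^esub> homology_class j X z'"
  then obtain b b' where "x = (\<lambda>\<sigma>. z \<sigma> + b \<sigma> + (z' \<sigma> + b' \<sigma>))" "b \<in> boundaries j X" "b' \<in> boundaries j X"
    unfolding homology_def homology_class_def by auto
  then show "x \<in> homology_class j X (\<lambda>\<sigma>. z \<sigma> + z' \<sigma>)"
    using boundaries_add[of b j X b'] by (auto simp: mem_homology_class algebra_simps)
next
  fix x assume "x \<in> homology_class j X (\<lambda>\<sigma>. z \<sigma> + z' \<sigma>)"
  then obtain b where x: "x = (\<lambda>\<sigma>. (z \<sigma> + b \<sigma>) + z' \<sigma>)" "b \<in> boundaries j X"
    unfolding homology_class_def by (auto simp: algebra_simps)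
  have "(\<lambda>\<sigma>. z \<sigma> + b \<sigma>) \<in> homology_class j X z" "z' \<in> homology_class j X z'"
    using x zero_boundaries by (auto simp: mem_homology_class)
  then show "x \<in> homology_class j X z \<oplus>\<^bsub>homology j X\<^esub> homology_class j X z'"
    unfolding homology_def x(1) by (auto intro!: exI)
qed

lemma smult_homology_class:
  "a \<odot>\<^bsub>homology j X\<^esub> homology_class j X z = homology_class j X (\<lambda>\<sigma>. a * z \<sigma>)"
proof (intro equalityI subsetI)
  fix x assume "x \<in> a \<odot>\<^bsub>homology j X\<^esub> homology_class j X z"
  then obtain b b' where "x = (\<lambda>\<sigma>. a * (z \<sigma> + b \<sigma>) + b' \<sigma>)" "b \<in> boundaries j X" "b' \<in> boundaries j X"
    unfolding homology_def homology_class_def by auto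
  then show "x \<in> homology_class j X (\<lambda>\<sigma>. a * z \<sigma>)"
    using boundaries_comb[of b j X b' a 1] by (auto simp: mem_homology_class algebra_simps)
next
  fix x assume "x \<in> homology_class j X (\<lambda>\<sigma>. a * z \<sigma>)"
  then obtain b where x: "x = (\<lambda>\<sigma>. a * z \<sigma> + b \<sigma>)" "b \<in> boundaries j X"
    unfolding homology_class_def by auto
  have "z \<in> homology_class j X z"
    using zero_boundaries by (auto simp: mem_homology_class)
  with x show "x \<in> a \<odot>\<^bsub>homology j X\<^esub> homology_class j X z"
    unfolding homology_def by auto
qed

lemma vectorspace_homology:
  "vectorspace (class_ring :: ('k::field) ring) (homology j X :: ('k, 'k chain set) module)"
proof -
  let ?H = "homology j X :: ('k, 'k chain set) module"
  let ?c = "homology_class j X :: 'k chain \<Rightarrow> 'k chain set"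
  have car: "carrier ?H = ?c ` cycles j X" by (simp add: homology_def)
  have zero: "\<zero>\<^bsub>?H\<^esub> = ?c (\<lambda>_. 0)" by (simp add: homology_def homology_class_def)
  have inv: "?c (\<lambda>\<sigma>. - z \<sigma>) \<oplus>\<^bsub>?H\<^esub> ?c z = \<zero>\<^bsub>?H\<^esub>" for z
    by (simp add: add_homology_class zero)
  have neg: "(\<lambda>\<sigma>. - z \<sigma>) \<in> cycles j X" if "z \<in> cycles j X" for z :: "'k chain"
    using cycles_scale[OF that, of "-1"] by simp
  have "abelian_group ?H"
    by (rule abelian_groupI)
       (auto simp: car zero add_homology_class add_ac zero_cycles
             intro!: cycles_add imageI bexI[OF _ neg])
  moreover have "cring (class_ring :: 'k ring)"
    by (rule class_cring.cring_axioms)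
  ultimately have "module (class_ring :: 'k ring) ?H"
    by (intro moduleI)
       (auto simp: car add_homology_class smult_homology_class algebra_simps
             intro!: cycles_scale imageI)
  then show ?thesis
    by (simp add: vectorspace_def class_field.field_axioms)
qed

definition betti :: "('k::field) itself \<Rightarrow> nat \<Rightarrow> cube set \<Rightarrow> nat" where
  "betti _ j X = vectorspace.dim (class_ring :: 'k ring) (homology j X :: ('k, 'k chain set) module)"

text \<open>Cochains on the \<open>j\<close>-cells of \<open>X\<close>, extended by zero to all plaquettes.\<close>

definition cochains :: "nat \<Rightarrow> cube set \<Rightarrow> (cube \<Rightarrow> 'k::field) set" where
  "cochains j X = {f. {\<sigma>. f \<sigma> \<noteq> 0} \<subseteq> cells j X}"

definition evaluate :: "(cube \<Rightarrow> 'k::field) \<Rightarrow> 'k chain \<Rightarrow> 'k" where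
  "evaluate f c = (\<Sum>\<sigma> | c \<sigma> \<noteq> 0. c \<sigma> * f \<sigma>)"

definition coboundary :: "(cube \<Rightarrow> 'k::field) \<Rightarrow> cube \<Rightarrow> 'k" where
  "coboundary f \<sigma> = evaluate f (cube_boundary \<sigma>)"


section \<open>The models on a finite complex\<close>

definition normalized_pmf :: "'a set \<Rightarrow> ('a \<Rightarrow> real) \<Rightarrow> 'a pmf" where
  "normalized_pmf S w = embed_pmf (\<lambda>x. if x \<in> S then w x / (\<Sum>y\<in>S. w y) else 0)"

lemma pmf_normalized_pmf:
  assumes "finite S" "\<And>x. x \<in> S \<Longrightarrow> w x \<ge> 0" "(\<Sum>y\<in>S. w y) > 0"
  shows "pmf (normalized_pmf S w) x = (if x \<in> S then w x / (\<Sum>y\<in>S. w y) else 0)"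
  unfolding normalized_pmf_def
proof (rule pmf_embed_pmf)
  show "0 \<le> (if x \<in> S then w x / sum w S else 0)" for x
    using assms by auto
  have "(\<integral>\<^sup>+x. ennreal (if x \<in> S then w x / sum w S else 0) \<partial>count_space UNIV)
      = (\<Sum>x\<in>S. ennreal (w x / sum w S))"
    using assms(1)
    by (subst nn_integral_count_space'[where A = S]) (auto intro!: sum.cong)
  also have "\<dots> = ennreal (\<Sum>x\<in>S. w x / sum w S)"
    using assms by (intro sum_ennreal) auto
  also have "(\<Sum>x\<in>S. w x / sum w S) = 1"
    using assms(3) by (simp flip: sum_divide_distrib)
  finally show "(\<integral>\<^sup>+x. ennreal (if x \<in> S then w x / sum w S else 0) \<partial>count_space UNIV) = 1"
    by simp
qed

definition prc_configs :: "nat \<Rightarrow> cube set \<Rightarrow> cube set set" where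
  "prc_configs i X =
     {P. P \<subseteq> X \<and> {\<sigma> \<in> X. cube_dim \<sigma> < i} \<subseteq> P \<and> (\<forall>\<sigma>\<in>P. cube_dim \<sigma> \<le> i)}"

definition prc_weight ::
  "('k::field) itself \<Rightarrow> nat \<Rightarrow> real \<Rightarrow> real \<Rightarrow> cube set \<Rightarrow> cube set \<Rightarrow> real" where
  "prc_weight F i p q X P =
     p ^ card (cells i P) * (1 - p) ^ (card (cells i X) - card (cells i P)) * q ^ betti F (i - 1) P"

definition prc_model ::
  "('k::field) itself \<Rightarrow> nat \<Rightarrow> real \<Rightarrow> real \<Rightarrow> cube set \<Rightarrow> cube set pmf" where
  "prc_model F i p q X = normalized_pmf (prc_configs i X) (prc_weight F i p q X)"

lemma pmf_prc_model:
  assumes "finite X" "0 \<le> p" "p < 1" "q > 0"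
  shows "pmf (prc_model F i p q X) P =
    (if P \<in> prc_configs i X
     then prc_weight F i p q X P / (\<Sum>P'\<in>prc_configs i X. prc_weight F i p q X P') else 0)"
proof -
  have fin: "finite (prc_configs i X)"
    using assms(1) by (auto simp: prc_configs_def intro: finite_subset[of _ "Pow X"])
  have nonneg: "prc_weight F i p q X P' \<ge> 0" for P'
    using assms by (simp add: prc_weight_def)
  let ?P = "{\<sigma> \<in> X. cube_dim \<sigma> < i}"
  have "cells i ?P = {}" by (auto simp: cells_def)
  then have "prc_weight F i p q X ?P > 0"
    using assms by (simp add: prc_weight_def)
  moreover have "?P \<in> prc_configs i X" by (auto simp: prc_configs_def)
  ultimately have "(\<Sum>P'\<in>prc_configs i X. prc_weight F i p q X P') > 0"
    using fin nonneg by (intro sum_pos2)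
  then show ?thesis
    unfolding prc_model_def using fin nonneg by (intro pmf_normalized_pmf)
qed

definition hamiltonian :: "nat \<Rightarrow> cube set \<Rightarrow> (cube \<Rightarrow> 'k::field) \<Rightarrow> real" where
  "hamiltonian i X f = - (\<Sum>\<sigma>\<in>cells i X. of_bool (coboundary f \<sigma> = 0))"

text \<open>The \<open>(i - 1)\<close>-dimensional theory; the number of states is the cardinality of the field.\<close>

definition potts_gauge :: "nat \<Rightarrow> real \<Rightarrow> cube set \<Rightarrow> (cube \<Rightarrow> ('p::prime_card) mod_ring) pmf" where
  "potts_gauge i \<beta> X = normalized_pmf (cochains (i - 1) X) (\<lambda>f. exp (- \<beta> * hamiltonian i X f))"

lemma finite_cochains:
  assumes "finite X"
  shows "finite (cochains j X :: (cube \<Rightarrow> 'k::{finite,field}) set)"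
proof -
  have "cochains j X \<subseteq> {f. \<forall>\<sigma>. (\<sigma> \<in> X \<longrightarrow> f \<sigma> \<in> (UNIV :: 'k set)) \<and> (\<sigma> \<notin> X \<longrightarrow> f \<sigma> = 0)}"
    by (auto simp: cochains_def cells_def)
  moreover have "finite \<dots>" using assms by (intro finite_set_of_finite_funs) auto
  ultimately show ?thesis by (rule finite_subset)
qed

lemma pmf_potts_gauge:
  assumes "finite X"
  shows "pmf (potts_gauge i \<beta> X :: (cube \<Rightarrow> ('p::prime_card) mod_ring) pmf) f =
    (if f \<in> cochains (i - 1) X
     then exp (- \<beta> * hamiltonian i X f) /
       (\<Sum>f'\<in>cochains (i - 1) X. exp (- \<beta> * hamiltonian i X (f' :: cube \<Rightarrow> 'p mod_ring)))
     else 0)"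
proof -
  have "(\<lambda>_. 0) \<in> (cochains (i - 1) X :: (cube \<Rightarrow> 'p mod_ring) set)"
    by (simp add: cochains_def)
  then have "(\<Sum>f'\<in>cochains (i - 1) X. exp (- \<beta> * hamiltonian i X (f' :: cube \<Rightarrow> 'p mod_ring))) > 0"
    using finite_cochains[OF assms] by (intro sum_pos) auto
  then show ?thesis
    unfolding potts_gauge_def using finite_cochains[OF assms] by (intro pmf_normalized_pmf) auto
qed


section \<open>Infinite volume\<close>

text \<open>
  Infinite-volume configurations are functions on the set of all plaquettes, with the product
  of discrete topologies. A random subcomplex is encoded by its membership predicate.
\<close>

definition config_topology :: "(cube \<Rightarrow> 's) topology" where
  "config_topology = product_topology (\<lambda>_. discrete_topology UNIV) UNIV"

definition weak_limit :: "(nat \<Rightarrow> (cube \<Rightarrow> 's) pmf) \<Rightarrow> (cube \<Rightarrow> 's) measure \<Rightarrow> bool" where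
  "weak_limit M N \<longleftrightarrow>
     prob_space N \<and>
     space N = UNIV \<and> sets N = sigma_sets UNIV {U. openin config_topology U} \<and>
     (\<forall>g :: (cube \<Rightarrow> 's) \<Rightarrow> real.
        continuous_map config_topology euclideanreal g \<and> bounded (range g) \<longrightarrow>
        (\<lambda>n. measure_pmf.expectation (M n) g) \<longlonglongrightarrow> (\<integral>x. g x \<partial>N))"

definition free_prc_model ::
  "('k::field) itself \<Rightarrow> nat \<Rightarrow> nat \<Rightarrow> real \<Rightarrow> real \<Rightarrow> (cube \<Rightarrow> bool) measure \<Rightarrow> bool" where
  "free_prc_model F d i p q \<mu> \<longleftrightarrow>
     weak_limit (\<lambda>n. map_pmf (\<lambda>P \<sigma>. \<sigma> \<in> P) (prc_model F i p q (box d n))) \<mu>"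

definition free_potts_gauge ::
  "nat \<Rightarrow> nat \<Rightarrow> real \<Rightarrow> (cube \<Rightarrow> ('p::prime_card) mod_ring) measure \<Rightarrow> bool" where
  "free_potts_gauge d i \<beta> \<nu> \<longleftrightarrow> weak_limit (\<lambda>n. potts_gauge i \<beta> (box d n)) \<nu>"

definition null_homologous :: "nat \<Rightarrow> ('k::field) chain \<Rightarrow> cube set \<Rightarrow> bool" where
  "null_homologous i \<gamma> P \<longleftrightarrow> (\<exists>\<rho>\<in>cell_chains i P. \<gamma> = boundary \<rho>)"

definition V_event :: "nat \<Rightarrow> ('k::field) chain \<Rightarrow> (cube \<Rightarrow> bool) set" where
  "V_event i \<gamma> = {\<omega>. null_homologous i \<gamma> {\<sigma>. \<omega> \<sigma>}}"

definition root_of_unity :: "('p::prime_card) mod_ring \<Rightarrow> complex" where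
  "root_of_unity g = exp (2 * pi * \<i> * of_int (to_int_mod_ring g) / of_nat CARD('p))"

definition wilson :: "('p::prime_card) mod_ring chain \<Rightarrow> (cube \<Rightarrow> 'p mod_ring) \<Rightarrow> complex" where
  "wilson \<gamma> f = root_of_unity (evaluate f \<gamma>)"

end

theory Submission
  imports Defs
begin

text \<open>
  In finite volume both sides are the same ratio. Write \<open>B S\<close> for the finite space of boundaries of
  chains supported on a set \<open>S\<close> of \<open>i\<close>-cells, and put \<open>x = exp \<beta> - 1 = p / (1 - p)\<close>. The claim is that the
  Wilson loop expectation and the probability of \<open>V_event i \<gamma>\<close> on a finite complex both equal the
  probability that \<open>\<gamma> \<in> B S\<close> when \<open>S\<close> is drawn with weight \<open>x ^ card S / card (B S)\<close>
  (\<open>boundary_weight\<close>).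

  For the gauge theory (\<open>expectation_wilson_potts_gauge\<close>), the Boltzmann factor is a product over the
  \<open>i\<close>-cells of \<open>1 + x\<close> or \<open>1\<close>, according to whether \<open>\<delta>f\<close> vanishes there. Expanding the product gives a sum over
  \<open>S\<close> of \<open>x ^ card S\<close> times the sum of \<open>W\<^sub>\<gamma> f\<close> over the cochains \<open>f\<close> that are closed on \<open>S\<close>, and these \<open>f\<close> are the
  ones that annihilate \<open>B S\<close>. By character orthogonality on \<open>B S\<close>, the indicator of this condition is the
  average of \<open>W\<^sub>b f\<close> over \<open>b \<in> B S\<close>. By orthogonality on the group of cochains, only \<open>b = -\<gamma>\<close> contributes, which
  leaves the number of cochains divided by \<open>card (B S)\<close> if \<open>\<gamma> \<in> B S\<close>, and \<open>0\<close> otherwise.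

  For the random-cluster model (\<open>prob_prc_model\<close>), all configurations contain the same cells of dimension
  below \<open>i\<close>, hence have the same \<open>(i - 1)\<close>-cycles. Since homology is cycles modulo boundaries,
  \<open>q\<close> to the power of the Betti number is the fixed number of cycles divided by \<open>card (B S)\<close> (\<open>card_cycles\<close>).

  The passage to infinite volume needs an argument, because the Wilson loop variable depends on finitely many
  cells but the event \<open>V_event i \<gamma>\<close> does not. The event is an increasing union of local events, those that a
  bounding chain exists inside a given finite set of cells. One inequality follows from this alone. The
  other holds because the free measures grow with the box on increasing events
  (\<open>prob_prc_model_mono\<close>): if \<open>n \<le> N\<close>, the event that \<open>\<gamma>\<close> bounds inside the box of radius \<open>n\<close> is at least
  as likely for the model in the box of radius \<open>N\<close>. This positive association comes from the
  four functions theorem of Ahlswede and Daykin, whose hypothesis reduces to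
  \<open>card (B (S \<union> T)) * card (B (S \<inter> T)) \<le> card (B S) * card (B T)\<close> (\<open>card_boundaries_lattice\<close>). That bound in
  turn holds because \<open>B (S \<union> T)\<close> is the sum of \<open>B S\<close> and \<open>B T\<close>, and \<open>B (S \<inter> T)\<close> lies in their intersection.
\<close>

section \<open>The four functions theorem and increasing events\<close>

text \<open>
  The four functions theorem for a set with one element. The cross terms \<open>x = a0 * b1\<close> and \<open>y = a1 * b0\<close> share the bounds
  \<open>T = c0 * d1\<close> and \<open>z = c1 * d0\<close>: both are at most \<open>T\<close>, and their product is at most \<open>T * z\<close>. Then
  \<open>0 \<le> (T - x) * (T - y)\<close> gives \<open>x + y \<le> T + z\<close> after division by \<open>T\<close>, while \<open>T = 0\<close> forces \<open>x = y = 0\<close>.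
\<close>

lemma four_numbers:
  fixes a0 a1 b0 b1 c0 c1 d0 d1 :: real
  assumes nonneg: "0 \<le> a0" "0 \<le> a1" "0 \<le> b0" "0 \<le> b1" "0 \<le> c0" "0 \<le> c1" "0 \<le> d0" "0 \<le> d1"
    and le: "a0 * b0 \<le> c0 * d0" "a0 * b1 \<le> c0 * d1" "a1 * b0 \<le> c0 * d1" "a1 * b1 \<le> c1 * d1"
  shows "(a0 + a1) * (b0 + b1) \<le> (c0 + c1) * (d0 + d1)"
proof -
  define T x y z where "T = c0 * d1" and "x = a0 * b1" and "y = a1 * b0" and "z = c1 * d0"
  have bounds: "x \<le> T" "y \<le> T" "0 \<le> x" "0 \<le> y" "0 \<le> z"
    using nonneg le by (simp_all add: T_def x_def y_def z_def)
  have "x + y \<le> T + z"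
  proof (cases "T = 0")
    case True
    then show ?thesis using bounds by simp
  next
    case False
    then have T: "T > 0" using bounds by simp
    have "(a0 * b0) * (a1 * b1) \<le> (c0 * d0) * (c1 * d1)"
      by (rule mult_mono) (use le nonneg in auto)
    then have "x * y \<le> T * z" by (simp add: T_def x_def y_def z_def algebra_simps)
    moreover have "0 \<le> (T - x) * (T - y)" using bounds by simp
    ultimately have "T * (x + y) \<le> T * (T + z)" by (simp add: algebra_simps)
    then show ?thesis using T by simp
  qed
  then show ?thesis using le by (simp add: T_def x_def y_def z_def algebra_simps)
qed

lemma sum_Pow_insert:
  assumes "finite E" "e \<notin> E"
  shows "(\<Sum>S\<in>Pow (insert e E). f S) = (\<Sum>S\<in>Pow E. f S + f (insert e S) :: real)"
proof -
  have "inj_on (insert e) (Pow E)" using assms by (auto simp: inj_on_def)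
  moreover have "Pow E \<inter> insert e ` Pow E = {}" using assms by auto
  ultimately show ?thesis
    using assms by (simp add: Pow_insert sum.union_disjoint sum.reindex sum.distrib)
qed

text \<open>
  The theorem of Ahlswede and Daykin. Merging the values at \<open>S\<close> and at \<open>insert e S\<close> into their sum
  removes one element of the ground set, and the one-element case shows that the merged functions satisfy the
  hypothesis again.
\<close>

theorem four_functions:
  fixes \<alpha> \<beta> \<phi> \<psi> :: "'a set \<Rightarrow> real"
  assumes "finite E"
    and "\<And>S. S \<subseteq> E \<Longrightarrow> 0 \<le> \<alpha> S \<and> 0 \<le> \<beta> S \<and> 0 \<le> \<phi> S \<and> 0 \<le> \<psi> S"
    and "\<And>S T. S \<subseteq> E \<Longrightarrow> T \<subseteq> E \<Longrightarrow> \<alpha> S * \<beta> T \<le> \<phi> (S \<inter> T) * \<psi> (S \<union> T)"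
  shows "(\<Sum>S\<in>Pow E. \<alpha> S) * (\<Sum>S\<in>Pow E. \<beta> S) \<le> (\<Sum>S\<in>Pow E. \<phi> S) * (\<Sum>S\<in>Pow E. \<psi> S)"
  using assms
proof (induction E arbitrary: \<alpha> \<beta> \<phi> \<psi>)
  case empty
  then show ?case using empty.prems(2)[of "{}" "{}"] by simp
next
  case (insert e E)
  let ?m = "\<lambda>f S. f S + f (insert e S) :: real"
  have "(\<Sum>S\<in>Pow E. ?m \<alpha> S) * (\<Sum>S\<in>Pow E. ?m \<beta> S) \<le> (\<Sum>S\<in>Pow E. ?m \<phi> S) * (\<Sum>S\<in>Pow E. ?m \<psi> S)"
  proof (rule insert.IH)
    fix S assume "S \<subseteq> E"
    then have "S \<subseteq> insert e E" "insert e S \<subseteq> insert e E" by auto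
    then show "0 \<le> ?m \<alpha> S \<and> 0 \<le> ?m \<beta> S \<and> 0 \<le> ?m \<phi> S \<and> 0 \<le> ?m \<psi> S"
      using insert.prems(1) by (meson add_nonneg_nonneg)
  next
    fix S T assume ST: "S \<subseteq> E" "T \<subseteq> E"
    then have sub: "S \<subseteq> insert e E" "insert e S \<subseteq> insert e E" "T \<subseteq> insert e E" "insert e T \<subseteq> insert e E"
      "S \<inter> T \<subseteq> insert e E" "S \<union> T \<subseteq> insert e E" 
      "insert e (S \<inter> T) \<subseteq> insert e E" "insert e (S \<union> T) \<subseteq> insert e E"  by auto
    have e: "e \<notin> S" "e \<notin> T" using ST insert.hyps by auto
    have eqs: "S \<inter> insert e T = S \<inter> T" "insert e S \<inter> T = S \<inter> T" 
       "insert e S \<inter> insert e T = insert e (S \<inter> T)"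
       "S \<union> insert e T = insert e (S \<union> T)" "insert e S \<union> T = insert e (S \<union> T)"
       "insert e S \<union> insert e T = insert e (S \<union> T)" using e by auto
    show "?m \<alpha> S * ?m \<beta> T \<le> ?m \<phi> (S \<inter> T) * ?m \<psi> (S \<union> T)"
      using insert.prems(1) insert.prems(2)[OF sub(1,3)] insert.prems(2)[OF sub(1,4)]
        insert.prems(2)[OF sub(2,3)] insert.prems(2)[OF sub(2,4)] sub
      unfolding eqs by (intro four_numbers) auto
  qed
  then show ?case using insert.hyps by (simp add: sum_Pow_insert)
qed

text \<open>
  Stochastic monotonicity in the ground set: under a log-supermodular weight, enlarging \<open>F\<close> to \<open>E\<close> makes an
  increasing event that looks at \<open>F\<close> only more likely. Cross-multiplication turns the two probabilities into
  products of sums, which is the form of the four functions theorem.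
\<close>

corollary increasing_event_mono:
  fixes w :: "'a set \<Rightarrow> real"
  assumes E: "finite E" "F \<subseteq> E"
    and w: "\<And>S. S \<subseteq> E \<Longrightarrow> 0 \<le> w S"
    and lattice: "\<And>S T. S \<subseteq> E \<Longrightarrow> T \<subseteq> E \<Longrightarrow> w S * w T \<le> w (S \<inter> T) * w (S \<union> T)"
    and mono: "\<And>S T. S \<subseteq> T \<Longrightarrow> Q S \<Longrightarrow> Q T"
  shows "(\<Sum>S\<in>Pow F. of_bool (Q S) * w S) * (\<Sum>S\<in>Pow E. w S) \<le>
         (\<Sum>S\<in>Pow F. w S) * (\<Sum>S\<in>Pow E. of_bool (Q (S \<inter> F)) * w S)"
proof -
  \<comment> \<open>Configurations on \<open>F\<close> are those on \<open>E\<close> that are empty outside \<open>F\<close>.\<close>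
  have restrict: "(\<Sum>S\<in>Pow F. h S) = (\<Sum>S\<in>Pow E. of_bool (S \<subseteq> F) * h S)" for h :: "'a set \<Rightarrow> real"
    using E by (intro sum.mono_neutral_cong_left) auto
  have "(\<Sum>S\<in>Pow E. of_bool (S \<subseteq> F) * (of_bool (Q S) * w S)) * (\<Sum>S\<in>Pow E. w S) \<le>
        (\<Sum>S\<in>Pow E. of_bool (S \<subseteq> F) * w S) * (\<Sum>S\<in>Pow E. of_bool (Q (S \<inter> F)) * w S)"
  proof (rule four_functions)
    fix S T assume ST: "S \<subseteq> E" "T \<subseteq> E"
    show "of_bool (S \<subseteq> F) * (of_bool (Q S) * w S) * w T
        \<le> of_bool (S \<inter> T \<subseteq> F) * w (S \<inter> T) * (of_bool (Q ((S \<union> T) \<inter> F)) * w (S \<union> T))"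
    proof (cases "S \<subseteq> F \<and> Q S")
      case True
      then have "S \<inter> T \<subseteq> F" "Q ((S \<union> T) \<inter> F)" using mono[of S "(S \<union> T) \<inter> F"] by auto
      then show ?thesis using True lattice[OF ST] by simp
    next
      case False
      have "0 \<le> w (S \<inter> T)" "0 \<le> w (S \<union> T)" using ST by (auto intro!: w)
      then show ?thesis using False by auto
    qed
  qed (use E w in auto)
  then show ?thesis unfolding restrict .
qed

section \<open>Chains and boundaries\<close>

lemma cell_chains_finite_support: "c \<in> cell_chains j X \<Longrightarrow> finite {\<sigma>. c \<sigma> \<noteq> 0}"
  by (simp add: cell_chains_def)

lemma evaluate_superset:
  assumes "finite A" "{\<sigma>. c \<sigma> \<noteq> 0} \<subseteq> A"
  shows "evaluate f c = (\<Sum>\<sigma>\<in>A. c \<sigma> * f \<sigma>)"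
  unfolding evaluate_def using assms by (intro sum.mono_neutral_left) auto

lemma evaluate_add:
  assumes "finite {\<sigma>. b \<sigma> \<noteq> 0}" "finite {\<sigma>. c \<sigma> \<noteq> 0}"
  shows "evaluate f (\<lambda>\<sigma>. b \<sigma> + c \<sigma>) = evaluate f b + evaluate f c"
proof -
  let ?A = "{\<sigma>. b \<sigma> \<noteq> 0} \<union> {\<sigma>. c \<sigma> \<noteq> 0}"
  have f: "finite ?A" using assms by simp
  show ?thesis
    by (subst (1 2 3) evaluate_superset[OF f]) (auto simp: sum.distrib algebra_simps)
qed

text \<open>
  Boundary and coboundary are adjoint for the pairing: both sides are the double sum of
  \<open>c \<sigma> * cube_boundary \<sigma> \<tau> * f \<tau>\<close>.
\<close>

lemma evaluate_boundary:
  assumes "finite {\<sigma>. c \<sigma> \<noteq> 0}"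
  shows "evaluate f (boundary c) = evaluate (coboundary f) c"
proof -
  let ?S = "{\<sigma>. c \<sigma> \<noteq> 0}"
  define A where "A = (\<Union>\<sigma>\<in>?S. {\<tau>. cube_boundary \<sigma> \<tau> \<noteq> (0::'a)})"
  have A: "finite A" using assms finite_faces by (auto simp: A_def)
  have "boundary c \<tau> = 0" if "\<tau> \<notin> A" for \<tau>
    unfolding boundary_def using that by (intro sum.neutral) (auto simp: A_def)
  then have "evaluate f (boundary c) = (\<Sum>\<tau>\<in>A. boundary c \<tau> * f \<tau>)"
    by (intro evaluate_superset A) auto
  also have "\<dots> = (\<Sum>\<sigma>\<in>?S. \<Sum>\<tau>\<in>A. c \<sigma> * (cube_boundary \<sigma> \<tau> * f \<tau>))"
    unfolding boundary_def sum_distrib_right mult.assoc by (rule sum.swap)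
  also have "\<dots> = (\<Sum>\<sigma>\<in>?S. c \<sigma> * coboundary f \<sigma>)"
  proof (intro sum.cong refl)
    fix \<sigma> assume "\<sigma> \<in> ?S"
    then have "coboundary f \<sigma> = (\<Sum>\<tau>\<in>A. cube_boundary \<sigma> \<tau> * f \<tau>)"
      unfolding coboundary_def by (intro evaluate_superset A) (auto simp: A_def)
    then show "(\<Sum>\<tau>\<in>A. c \<sigma> * (cube_boundary \<sigma> \<tau> * f \<tau>)) = c \<sigma> * coboundary f \<sigma>"
      by (simp add: sum_distrib_left)
  qed
  finally show ?thesis by (simp add: evaluate_def)
qed

lemma boundary_eq_evaluate: "boundary c \<tau> = evaluate (\<lambda>\<sigma>. cube_boundary \<sigma> \<tau>) c"
  by (simp add: boundary_def evaluate_def)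

text \<open>
  The value of \<open>\<partial>\<partial>c\<close> at \<open>\<tau>\<close> is the pairing of \<open>\<partial>c\<close> with the cochain \<open>\<sigma> \<mapsto> \<partial>\<sigma>(\<tau>)\<close>. The coboundary of that cochain vanishes
  because \<open>\<partial>\<partial>\<close> vanishes on single plaquettes.
\<close>

lemma boundary_boundary:
  fixes c :: "'k::field chain"
  assumes "finite {\<sigma>. c \<sigma> \<noteq> 0}"
  shows "boundary (boundary c) = (\<lambda>_. 0)"
proof
  fix \<tau>
  have "coboundary (\<lambda>\<sigma>. cube_boundary \<sigma> \<tau>) \<rho> = (0::'k)" for \<rho>
    unfolding coboundary_def boundary_eq_evaluate[symmetric] boundary_cube_boundary ..
  then show "boundary (boundary c) \<tau> = 0"
    unfolding boundary_eq_evaluate[of "boundary c"] evaluate_boundary[OF assms]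
    by (simp add: evaluate_def)
qed

text \<open>
  Being a subcomplex, expressed through the codimension-one faces.
\<close>

definition face_closed :: "cube set \<Rightarrow> bool" where
  "face_closed X \<longleftrightarrow> (\<forall>\<sigma>\<in>X. \<forall>k<length \<sigma>. \<forall>a. \<sigma> ! k = Edge a \<longrightarrow> \<sigma>[k := Pt a] \<in> X \<and> \<sigma>[k := Pt (a + 1)] \<in> X)"

lemma cube_boundary_nonzeroE:
  assumes "cube_boundary \<sigma> \<tau> \<noteq> (0::'k::field)"
  obtains k a where "k < length \<sigma>" "\<sigma> ! k = Edge a" "\<tau> = \<sigma>[k := Pt a] \<or> \<tau> = \<sigma>[k := Pt (a + 1)]"
proof -
  obtain k where "k < length \<sigma>" "(case \<sigma> ! k of Pt a \<Rightarrow> 0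
    | Edge a \<Rightarrow> (-1) ^ cube_dim (take k \<sigma>) *
        (of_bool (\<tau> = \<sigma>[k := Pt (a + 1)]) - of_bool (\<tau> = \<sigma>[k := Pt a]))) \<noteq> (0::'k)"
    using assms unfolding cube_boundary_def by (meson lessThan_iff sum.neutral)
  then show ?thesis using that by (auto split: interval.splits simp: of_bool_def split: if_splits)
qed

lemma cube_dim_face:
  assumes "k < length \<sigma>" "\<sigma> ! k = Edge a"
  shows "cube_dim \<sigma> = Suc (cube_dim (\<sigma>[k := Pt b]))"
proof -
  have *: "cube_dim (take k \<sigma> @ \<sigma> ! k # drop (Suc k) \<sigma>) = Suc (cube_dim (\<sigma>[k := Pt b]))"
    using assms unfolding upd_conv_take_nth_drop[OF assms(1)] by (simp add: cube_dim_def is_edge_def)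
  show ?thesis
    by (subst id_take_nth_drop[OF assms(1)]) (rule *)
qed

lemma boundary_in_cell_chains:
  assumes c: "c \<in> cell_chains (Suc j) X" and X: "face_closed X"
  shows "boundary c \<in> cell_chains j X"
proof -
  let ?A = "\<Union>\<sigma>\<in>{\<sigma>. c \<sigma> \<noteq> 0}. {\<tau>. cube_boundary \<sigma> \<tau> \<noteq> (0::'a)}"
  have sub: "{\<tau>. boundary c \<tau> \<noteq> 0} \<subseteq> ?A"
  proof
    fix \<tau> assume "\<tau> \<in> {\<tau>. boundary c \<tau> \<noteq> 0}"
    then have "(\<Sum>\<sigma> | c \<sigma> \<noteq> 0. c \<sigma> * cube_boundary \<sigma> \<tau>) \<noteq> 0" by (simp add: boundary_def)
    then obtain \<sigma> where "c \<sigma> \<noteq> 0" "c \<sigma> * cube_boundary \<sigma> \<tau> \<noteq> 0"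
      by (metis (mono_tags, lifting) mem_Collect_eq sum.neutral)
    then show "\<tau> \<in> ?A" by auto
  qed
  moreover have "finite ?A" using c finite_faces by (auto simp: cell_chains_def)
  moreover have "?A \<subseteq> cells j X"
  proof
    fix \<tau> assume "\<tau> \<in> ?A"
    then obtain \<sigma> where s: "\<sigma> \<in> cells (Suc j) X" "cube_boundary \<sigma> \<tau> \<noteq> (0::'a)"
      using c by (auto simp: cell_chains_def)
    from s(2) obtain k a where k: "k < length \<sigma>" "\<sigma> ! k = Edge a" "\<tau> = \<sigma>[k := Pt a] \<or> \<tau> = \<sigma>[k := Pt (a + 1)]"
      by (rule cube_boundary_nonzeroE)
    then show "\<tau> \<in> cells j X" using s(1) X cube_dim_face[OF k(1,2)]
      by (auto simp: cells_def face_closed_def)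
  qed
  ultimately show ?thesis by (auto simp: cell_chains_def intro: finite_subset)
qed

lemma boundaries_subset_cell_chains:
  assumes "face_closed X" "S \<subseteq> X"
  shows "boundaries j S \<subseteq> cell_chains j X"
  using assms boundary_in_cell_chains[of _ j X]
  by (auto simp: boundaries_def cell_chains_def cells_def)

lemma boundaries_subset_cycles:
  assumes "face_closed X"
  shows "boundaries j X \<subseteq> cycles j X"
  using boundaries_subset_cell_chains[OF assms subset_refl]
  by (auto simp: cycles_def boundaries_def boundary_boundary cell_chains_finite_support)

lemma finite_cell_chains:
  assumes "finite X" shows "finite (cell_chains j X :: 'k::{finite,field} chain set)"
  using finite_cochains[OF assms] by (rule finite_subset[rotated]) (auto simp: cell_chains_def cochains_def)

lemma finite_boundaries:
  "finite X \<Longrightarrow> finite (boundaries j X :: 'k::{finite,field} chain set)"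
  by (simp add: boundaries_def finite_cell_chains)

lemma card_boundaries_pos:
  "finite X \<Longrightarrow> card (boundaries j X :: 'k::{finite,field} chain set) > 0"
  using finite_boundaries zero_boundaries by (metis card_gt_0_iff empty_iff)

lemma cell_chains_cells: "cell_chains j (cells j X) = cell_chains j X"
  by (simp add: cell_chains_def cells_def)

lemma boundaries_cells: "boundaries j (cells (Suc j) X) = boundaries j X"
  by (simp add: boundaries_def cell_chains_cells)

lemma boundaries_mono: "S \<subseteq> T \<Longrightarrow> boundaries j S \<subseteq> boundaries j T"
  unfolding boundaries_def cell_chains_def cells_def by (intro image_mono) auto

text \<open>
  A chain on \<open>S \<union> T\<close> is split into its parts on \<open>S\<close> and off \<open>S\<close>.
\<close>

lemma boundaries_Un_decompose:
  assumes "c \<in> boundaries j (S \<union> T)"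
  obtains u v where "u \<in> boundaries j S" "v \<in> boundaries j T" "c = (\<lambda>\<sigma>. u \<sigma> + v \<sigma>)"
proof -
  obtain r where r: "r \<in> cell_chains (Suc j) (S \<union> T)" "c = boundary r"
    using assms by (auto simp: boundaries_def)
  define s t where "s = (\<lambda>\<sigma>. of_bool (\<sigma> \<in> S) * r \<sigma>)" and "t = (\<lambda>\<sigma>. of_bool (\<sigma> \<notin> S) * r \<sigma>)"
  have s: "s \<in> cell_chains (Suc j) S" and t: "t \<in> cell_chains (Suc j) T"
    using r(1) by (auto simp: s_def t_def cell_chains_def cells_def elim!: rev_finite_subset)
  have "r = (\<lambda>\<sigma>. s \<sigma> + t \<sigma>)" by (auto simp: s_def t_def)
  moreover have "boundary (\<lambda>\<sigma>. s \<sigma> + t \<sigma>) = (\<lambda>\<sigma>. boundary s \<sigma> + boundary t \<sigma>)"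
    using s t by (auto simp: boundary_eq_evaluate evaluate_add cell_chains_def)
  ultimately show ?thesis using s t r that by (auto simp: boundaries_def)
qed

text \<open>
  The boundaries of \<open>S \<union> T\<close> are sums of boundaries of \<open>S\<close> and of \<open>T\<close>, and the boundaries of \<open>S \<inter> T\<close> are common to both.
  This yields an injection of the pairs counted on the left into those counted on the right: having chosen a decomposition
  \<open>c = u c + v c\<close> of each boundary \<open>c\<close> on \<open>S \<union> T\<close>, send \<open>(c, k)\<close> to \<open>(u c + k, v c - k)\<close>. The sum of the two components
  recovers \<open>c\<close>, then the first component recovers \<open>k\<close>.
\<close>

lemma card_boundaries_lattice:
  assumes "finite S" "finite T"
  shows "card (boundaries j (S \<union> T) :: 'k::{finite,field} chain set) * card (boundaries j (S \<inter> T) :: 'k chain set)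
     \<le> card (boundaries j S :: 'k chain set) * card (boundaries j T :: 'k chain set)"
proof -
  let ?B = "boundaries j :: cube set \<Rightarrow> 'k chain set"
  have "\<forall>c\<in>?B (S \<union> T). \<exists>u v. u \<in> ?B S \<and> v \<in> ?B T \<and> c = (\<lambda>\<sigma>. u \<sigma> + v \<sigma>)"
  proof
    fix c :: "'k chain" assume "c \<in> ?B (S \<union> T)"
    then obtain u v where "u \<in> ?B S" "v \<in> ?B T" "c = (\<lambda>\<sigma>. u \<sigma> + v \<sigma>)"
      by (rule boundaries_Un_decompose)
    then show "\<exists>u v. u \<in> ?B S \<and> v \<in> ?B T \<and> c = (\<lambda>\<sigma>. u \<sigma> + v \<sigma>)" by (intro exI conjI)
  qed
  then obtain u v where uv: "u c \<in> ?B S" "v c \<in> ?B T" "c = (\<lambda>\<sigma>. u c \<sigma> + v c \<sigma>)"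
    if "c \<in> ?B (S \<union> T)" for c by metis
  let ?f = "\<lambda>(c, k). (\<lambda>\<sigma>. u c \<sigma> + k \<sigma>, \<lambda>\<sigma>. v c \<sigma> - k \<sigma>)"
  have "inj_on ?f (?B (S \<union> T) \<times> ?B (S \<inter> T))"
  proof (rule inj_onI, clarify)
    fix c k c' k' :: "'k chain"
    assume c: "c \<in> ?B (S \<union> T)" "c' \<in> ?B (S \<union> T)"
      and eq: "(\<lambda>\<sigma>. u c \<sigma> + k \<sigma>) = (\<lambda>\<sigma>. u c' \<sigma> + k' \<sigma>)" "(\<lambda>\<sigma>. v c \<sigma> - k \<sigma>) = (\<lambda>\<sigma>. v c' \<sigma> - k' \<sigma>)"
    have "c \<sigma> = c' \<sigma>" for \<sigma>
    proof -
      have "c \<sigma> = (u c \<sigma> + k \<sigma>) + (v c \<sigma> - k \<sigma>)" using fun_cong[OF uv(3)[OF c(1)], of \<sigma>] by simp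
      also have "\<dots> = (u c' \<sigma> + k' \<sigma>) + (v c' \<sigma> - k' \<sigma>)"
        using fun_cong[OF eq(1), of \<sigma>] fun_cong[OF eq(2), of \<sigma>] by simp
      also have "\<dots> = c' \<sigma>" using fun_cong[OF uv(3)[OF c(2)], of \<sigma>] by simp
      finally show ?thesis .
    qed
    then have "c = c'" by blast
    moreover have "k = k'"
    proof
      show "k \<sigma> = k' \<sigma>" for \<sigma>
        using fun_cong[OF eq(1), of \<sigma>] \<open>c = c'\<close> by simp
    qed
    ultimately show "c = c' \<and> k = k'" by simp
  qed
  moreover have "?f ` (?B (S \<union> T) \<times> ?B (S \<inter> T)) \<subseteq> ?B S \<times> ?B T"
  proof clarify
    fix c k assume c: "c \<in> ?B (S \<union> T)" and k: "k \<in> ?B (S \<inter> T)"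
    have "k \<in> ?B S" "k \<in> ?B T" using k boundaries_mono[of "S \<inter> T"] by blast+
    then show "(\<lambda>\<sigma>. u c \<sigma> + k \<sigma>) \<in> ?B S \<and> (\<lambda>\<sigma>. v c \<sigma> - k \<sigma>) \<in> ?B T"
      using boundaries_add[OF uv(1)[OF c]] boundaries_diff[OF uv(2)[OF c]] by blast
  qed
  ultimately have "card (?B (S \<union> T) \<times> ?B (S \<inter> T)) \<le> card (?B S \<times> ?B T)"
    using assms by (intro card_inj_on_le[where f = ?f] finite_cartesian_product finite_boundaries) auto
  then show ?thesis by (simp add: card_cartesian_product)
qed

section \<open>Betti numbers by counting cycles and boundaries\<close>

text \<open>
  Vectors correspond to coordinate functions with respect to a basis.
\<close>

lemma (in vectorspace) card_carrier_eq:
  assumes "finite (carrier V)"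
  shows "card (carrier V) = card (carrier K) ^ dim"
proof -
  have "gen_set (carrier V)"
    using in_own_span[of "carrier V"] span_is_subset2[of "carrier V"] by auto
  then have "fin_dim" using assms unfolding fin_dim_def by blast
  then obtain A where A: "finite A" "basis A" using finite_basis_exists by blast
  then have AV: "A \<subseteq> carrier V" by (simp add: basis_def)
  have "\<forall>v. v \<in> carrier V \<longrightarrow> (\<exists>!a. a \<in> A \<rightarrow>\<^sub>E carrier K \<and> lincomb a A = v)"
    using basis_criterion[OF A(1) AV] A(2) by blast
  moreover have "lincomb a A \<in> carrier V" if "a \<in> A \<rightarrow>\<^sub>E carrier K" for a
    using that AV by (intro lincomb_closed) (auto simp: PiE_def)
  ultimately have "bij_betw (\<lambda>a. lincomb a A) (A \<rightarrow>\<^sub>E carrier K) (carrier V)"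
    unfolding bij_betw_def inj_on_def image_def by blast
  then have "card (carrier V) = card (A \<rightarrow>\<^sub>E carrier K)" by (simp add: bij_betw_same_card)
  then show ?thesis using A by (simp add: card_PiE dim_basis)
qed

lemma homology_class_eq_image: "homology_class j X z = (\<lambda>b \<sigma>. z \<sigma> + b \<sigma>) ` boundaries j X"
  by (auto simp: homology_class_def)

text \<open>
  Lagrange's theorem for the quotient of cycles by boundaries: the homology classes partition the cycles into
  cosets with as many elements as there are boundaries.
\<close>

lemma card_cycles:
  assumes "finite X" "face_closed X"
  shows "card (cycles j X :: 'k::{finite,field} chain set)
    = CARD('k) ^ betti TYPE('k) j X * card (boundaries j X :: 'k chain set)"
proof -
  let ?Z = "cycles j X :: 'k chain set" and ?B = "boundaries j X :: 'k chain set"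
  let ?H = "homology j X :: ('k, 'k chain set) module"
  interpret vectorspace "class_ring :: 'k ring" ?H by (rule vectorspace_homology)
  have car: "carrier ?H = homology_class j X ` ?Z" by (simp add: homology_def)
  have fin: "finite ?Z"
    using finite_cell_chains[OF assms(1)] by (rule finite_subset[rotated]) (auto simp: cycles_def)
  have Un: "\<Union> (carrier ?H) = ?Z"
  proof
    show "\<Union> (carrier ?H) \<subseteq> ?Z"
      using boundaries_subset_cycles[OF assms(2)]
      by (auto simp: car homology_class_eq_image intro!: cycles_add)
    show "?Z \<subseteq> \<Union> (carrier ?H)"
      by (auto simp: car mem_homology_class zero_boundaries intro!: bexI)
  qed
  have "card ?B * card (carrier ?H) = card (\<Union> (carrier ?H))"
  proof (rule card_partition)
    show "finite (carrier ?H)" using fin by (simp add: car)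
    show "finite (\<Union> (carrier ?H))" using fin Un by simp
    show "card U = card ?B" if "U \<in> carrier ?H" for U
      using that by (auto simp: car homology_class_eq_image fun_eq_iff inj_on_def intro!: card_image)
    show "U \<inter> U' = {}" if U: "U \<in> carrier ?H" "U' \<in> carrier ?H" "U \<noteq> U'" for U U'
    proof (rule ccontr)
      assume "U \<inter> U' \<noteq> {}"
      then obtain w where w: "w \<in> U" "w \<in> U'" by blast
      obtain z z' where z: "U = homology_class j X z" "U' = homology_class j X z'"
        using U car by auto
      \<comment> \<open>A class is determined by any of its members.\<close>
      have "homology_class j X y = homology_class j X w" if "w \<in> homology_class j X y" for y :: "'k chain"
      proof -
        have b: "(\<lambda>\<sigma>. w \<sigma> - y \<sigma>) \<in> ?B" using that by (simp add: mem_homology_class)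
        have "(\<lambda>\<sigma>. x \<sigma> - y \<sigma>) \<in> ?B \<longleftrightarrow> (\<lambda>\<sigma>. x \<sigma> - w \<sigma>) \<in> ?B" for x
          using boundaries_diff[OF _ b, of "\<lambda>\<sigma>. x \<sigma> - y \<sigma>"] boundaries_add[OF _ b, of "\<lambda>\<sigma>. x \<sigma> - w \<sigma>"]
          by auto
        then show ?thesis by (auto simp: mem_homology_class)
      qed
      then have "U = U'" using w unfolding z by blast
      then show False using U by blast
    qed
  qed
  moreover have "card (carrier ?H) = CARD('k) ^ dim"
    using fin by (subst card_carrier_eq) (auto simp: car)
  ultimately show ?thesis by (simp add: Un betti_def mult.commute)
qed

section \<open>Character orthogonality\<close>

lemma root_of_unity_0 [simp]: "root_of_unity 0 = 1"
  by (simp add: root_of_unity_def)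

lemma root_of_unity_add:
  "root_of_unity (a + b :: ('p::prime_card) mod_ring) = root_of_unity a * root_of_unity b"
proof -
  let ?n = "to_int_mod_ring :: 'p mod_ring \<Rightarrow> int" and ?q = "int CARD('p)"
  let ?E = "\<lambda>m. 2 * pi * \<i> * of_int m / of_nat CARD('p) :: complex"
  \<comment> \<open>\<open>k\<close> is the carry of the addition modulo \<open>q\<close>; it changes the exponent by a period of \<open>exp\<close>.\<close>
  define k where "k = (?n a + ?n b) div ?q"
  have "?n a + ?n b = ?n (a + b) + ?q * k"
    by (simp add: to_int_mod_ring_add k_def)
  then have "?E (?n a + ?n b) = ?E (?n (a + b) + ?q * k)" by simp
  then have "?E (?n a) + ?E (?n b) = ?E (?n (a + b)) + \<i> * (of_int k * (of_real pi * 2))"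
    by (simp add: field_simps)
  then show ?thesis
    unfolding root_of_unity_def by (simp only: exp_add[symmetric] exp_plus_2pin)
qed

lemma root_of_unity_eq_1_iff:
  "root_of_unity (a :: ('p::prime_card) mod_ring) = 1 \<longleftrightarrow> a = 0"
proof
  assume "root_of_unity a = 1"
  then obtain n where "2 * pi * of_int (to_int_mod_ring a) / of_nat CARD('p) = of_int (2 * n) * pi"
    unfolding root_of_unity_def exp_eq_1 by auto
  then have "real_of_int (to_int_mod_ring a) = of_int (n * int CARD('p))"
    by (simp add: field_simps)
  then have "to_int_mod_ring a = n * int CARD('p)" by linarith
  moreover have "to_int_mod_ring a \<in> {0..<int CARD('p)}"
    using range_to_int_mod_ring by blast
  ultimately have "to_int_mod_ring a = 0"
    by (metis atLeastLessThan_iff mod_mult_self2_is_0 mod_pos_pos_trivial)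
  then show "a = 0" by simp
qed simp

lemma norm_root_of_unity [simp]: "norm (root_of_unity a) = 1"
  by (simp add: root_of_unity_def)

text \<open>
  Orthogonality in the form used twice below: a translation of the group multiplies the sum of a character by a
  value different from 1.
\<close>

lemma sum_eq_0_if_shifted:
  fixes \<phi> :: "'a \<Rightarrow> complex"
  assumes "finite G" "t ` G \<subseteq> G" "inj_on t G" "\<And>g. g \<in> G \<Longrightarrow> \<phi> (t g) = c * \<phi> g" "c \<noteq> 1"
  shows "(\<Sum>g\<in>G. \<phi> g) = 0"
proof -
  have "t ` G = G" using assms by (intro endo_inj_surj)
  then have "(\<Sum>g\<in>G. \<phi> g) = (\<Sum>g\<in>G. \<phi> (t g))"
    using sum.reindex[OF assms(3), of \<phi>] by simp
  also have "\<dots> = c * (\<Sum>g\<in>G. \<phi> g)" using assms(4) by (simp add: sum_distrib_left)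
  finally show ?thesis using assms(5) by (metis mult_cancel_right1)
qed

text \<open>
  The character \<open>f \<mapsto> W\<^sub>c f\<close> of the group of cochains is nontrivial if \<open>c \<noteq> 0\<close>: changing \<open>f\<close> by 1 at a cell \<open>\<sigma>\<close> with
  \<open>c \<sigma> \<noteq> 0\<close> changes the value.
\<close>

lemma sum_wilson_cochains:
  fixes c :: "('p::prime_card) mod_ring chain"
  assumes X: "finite X" and c: "c \<in> cell_chains j X"
  shows "(\<Sum>f\<in>cochains j X. wilson c f)
    = (if c = (\<lambda>_. 0) then of_nat (card (cochains j X :: 'p mod_ring chain set)) else 0)"
proof (cases "c = (\<lambda>_. 0)")
  case True
  then show ?thesis by (simp add: wilson_def evaluate_def)
next
  case False
  then obtain \<sigma> where \<sigma>: "c \<sigma> \<noteq> 0" by blast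
  then have \<sigma>X: "\<sigma> \<in> cells j X" using c by (auto simp: cell_chains_def)
  have fin: "finite {\<sigma>. c \<sigma> \<noteq> 0}" using c by (simp add: cell_chains_def)
  let ?t = "\<lambda>f \<tau>. f \<tau> + of_bool (\<tau> = \<sigma>) :: 'p mod_ring"
  have "evaluate (?t f) c = c \<sigma> + evaluate f c" for f
    using fin \<sigma> by (simp add: evaluate_def algebra_simps sum.distrib of_bool_def if_distrib[of "\<lambda>x. _ * x"] sum.delta' cong: if_cong)
  then have "wilson c (?t f) = root_of_unity (c \<sigma>) * wilson c f" for f
    by (simp add: wilson_def root_of_unity_add)
  then have "(\<Sum>f\<in>cochains j X. wilson c f) = 0"
    using \<sigma>X \<sigma> finite_cochains[OF X]
    by (intro sum_eq_0_if_shifted[where t = ?t and c = "root_of_unity (c \<sigma>)"])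
       (auto simp: cochains_def inj_on_def fun_eq_iff root_of_unity_eq_1_iff of_bool_def split: if_splits)
  then show ?thesis using False by simp
qed

lemma evaluate_boundaries_eq_0_iff:
  fixes f :: "cube \<Rightarrow> 'k::field"
  assumes "S \<subseteq> cells (Suc j) X"
  shows "(\<forall>b\<in>boundaries j S. evaluate f b = 0) \<longleftrightarrow> (\<forall>\<sigma>\<in>S. coboundary f \<sigma> = 0)"
proof
  assume kills: "\<forall>b\<in>boundaries j S. evaluate f b = 0"
  show "\<forall>\<sigma>\<in>S. coboundary f \<sigma> = 0"
  proof
    fix \<sigma> assume \<sigma>: "\<sigma> \<in> S"
    let ?e = "\<lambda>\<tau>. of_bool (\<tau> = \<sigma>) :: 'k"
    have supp: "{\<tau>. ?e \<tau> \<noteq> 0} = {\<sigma>}" by auto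
    have "?e \<in> cell_chains (Suc j) S"
      using \<sigma> assms by (auto simp: cell_chains_def cells_def)
    then have "evaluate f (boundary ?e) = 0" using kills by (auto simp: boundaries_def)
    moreover have "evaluate f (boundary ?e) = coboundary f \<sigma>"
      using supp by (simp add: evaluate_boundary) (simp add: evaluate_def)
    ultimately show "coboundary f \<sigma> = 0" by simp
  qed
next
  assume "\<forall>\<sigma>\<in>S. coboundary f \<sigma> = 0"
  then show "\<forall>b\<in>boundaries j S. evaluate f b = 0"
    by (auto simp: boundaries_def evaluate_boundary cell_chains_finite_support)
       (auto simp: evaluate_def cell_chains_def cells_def intro!: sum.neutral)
qed

text \<open>
  The same for the character \<open>b \<mapsto> W\<^sub>b f\<close> of the group of boundaries, which is trivial exactly if \<open>f\<close> annihilates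
  them, that is, if \<open>f\<close> is closed on \<open>S\<close>.
\<close>

lemma sum_wilson_boundaries:
  fixes f :: "cube \<Rightarrow> ('p::prime_card) mod_ring"
  assumes S: "finite S" "S \<subseteq> cells (Suc j) X" and X: "face_closed X"
  shows "(\<Sum>b\<in>boundaries j S. wilson b f)
    = of_nat (card (boundaries j S :: 'p mod_ring chain set)) * of_bool (\<forall>\<sigma>\<in>S. coboundary f \<sigma> = 0)"
proof (cases "\<forall>b\<in>boundaries j S. evaluate f b = 0")
  case True
  moreover from True have "\<forall>\<sigma>\<in>S. coboundary f \<sigma> = 0"
    using evaluate_boundaries_eq_0_iff[OF S(2)] by blast
  ultimately show ?thesis by (simp add: wilson_def)
next
  case False
  then have nz: "\<not> (\<forall>\<sigma>\<in>S. coboundary f \<sigma> = 0)"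
    using evaluate_boundaries_eq_0_iff[OF S(2)] by blast
  obtain b0 where b0: "b0 \<in> boundaries j S" "evaluate f b0 \<noteq> 0" using False by blast
  have sub: "S \<subseteq> X" using S by (auto simp: cells_def)
  have fin: "finite {\<sigma>. b \<sigma> \<noteq> 0}" if "b \<in> boundaries j S" for b :: "'p mod_ring chain"
    using that boundaries_subset_cell_chains[OF X sub] by (auto intro: cell_chains_finite_support)
  let ?t = "\<lambda>b \<sigma>. b0 \<sigma> + b \<sigma>"
  have "wilson (?t b) f = root_of_unity (evaluate f b0) * wilson b f" if "b \<in> boundaries j S" for b
    using that b0 fin by (simp add: wilson_def evaluate_add root_of_unity_add)
  then have "(\<Sum>b\<in>boundaries j S. wilson b f) = 0"
    using b0 finite_boundaries[OF S(1)]
    by (intro sum_eq_0_if_shifted[where t = ?t and c = "root_of_unity (evaluate f b0)"])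
       (auto simp: inj_on_def fun_eq_iff root_of_unity_eq_1_iff intro!: boundaries_add)
  then show ?thesis using nz by simp
qed

text \<open>
  The indicator that \<open>f\<close> is closed on \<open>S\<close> is the average of \<open>W\<^sub>b f\<close> over the boundaries \<open>b\<close> of \<open>S\<close>. After
  exchanging the sums, the sum over all cochains kills every term except \<open>b = -\<gamma>\<close>. For \<open>\<gamma> = 0\<close> this counts the cochains
  that are closed on \<open>S\<close>.
\<close>

lemma sum_wilson_cocycles:
  fixes \<gamma> :: "('p::prime_card) mod_ring chain"
  assumes X: "finite X" "face_closed X" and S: "S \<subseteq> cells (Suc j) X"
    and \<gamma>: "\<gamma> \<in> cell_chains j X"
  shows "(\<Sum>f\<in>cochains j X. of_bool (\<forall>\<sigma>\<in>S. coboundary f \<sigma> = 0) * wilson \<gamma> f)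
    = of_nat (card (cochains j X :: 'p mod_ring chain set)) / of_nat (card (boundaries j S :: 'p mod_ring chain set))
      * of_bool (\<gamma> \<in> boundaries j S)"
    (is "?L = _")
proof -
  let ?C = "cochains j X :: 'p mod_ring chain set" and ?B = "boundaries j S :: 'p mod_ring chain set"
  have sub: "S \<subseteq> X" using S by (auto simp: cells_def)
  have finS: "finite S" using sub X(1) finite_subset by blast
  have BX: "?B \<subseteq> cell_chains j X" by (rule boundaries_subset_cell_chains[OF X(2) sub])
  have "of_nat (card ?B) * ?L = (\<Sum>f\<in>?C. \<Sum>b\<in>?B. wilson b f * wilson \<gamma> f)"
    by (simp add: sum_wilson_boundaries[OF finS S X(2)] sum_distrib_left mult.assoc flip: sum_distrib_right)
  also have "\<dots> = (\<Sum>b\<in>?B. \<Sum>f\<in>?C. wilson (\<lambda>\<sigma>. b \<sigma> + \<gamma> \<sigma>) f)"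
  proof (subst sum.swap, intro sum.cong refl)
    fix b f assume "b \<in> ?B"
    then have "finite {\<sigma>. b \<sigma> \<noteq> 0}" using BX cell_chains_finite_support by blast
    then show "wilson b f * wilson \<gamma> f = wilson (\<lambda>\<sigma>. b \<sigma> + \<gamma> \<sigma>) f"
      using \<gamma> by (simp add: wilson_def evaluate_add root_of_unity_add cell_chains_finite_support)
  qed
  also have "\<dots> = (\<Sum>b\<in>?B. if b = (\<lambda>\<sigma>. - \<gamma> \<sigma>) then of_nat (card ?C) else 0)"
  proof (intro sum.cong refl)
    fix b assume "b \<in> ?B"
    then have "(\<lambda>\<sigma>. b \<sigma> + \<gamma> \<sigma>) \<in> cell_chains j X"
      using BX \<gamma> chains_comb[of b j X \<gamma> 1 1] by auto
    moreover have "(\<lambda>\<sigma>. b \<sigma> + \<gamma> \<sigma>) = (\<lambda>_. 0) \<longleftrightarrow> b = (\<lambda>\<sigma>. - \<gamma> \<sigma>)"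
      by (simp add: fun_eq_iff eq_neg_iff_add_eq_0)
    ultimately show "(\<Sum>f\<in>?C. wilson (\<lambda>\<sigma>. b \<sigma> + \<gamma> \<sigma>) f) = (if b = (\<lambda>\<sigma>. - \<gamma> \<sigma>) then of_nat (card ?C) else 0)"
      by (simp add: sum_wilson_cochains[OF X(1)])
  qed
  also have "\<dots> = of_nat (card ?C) * of_bool ((\<lambda>\<sigma>. - \<gamma> \<sigma>) \<in> ?B)"
    by (simp add: sum.delta[OF finite_boundaries[OF finS]])
  also have "(\<lambda>\<sigma>. - \<gamma> \<sigma>) \<in> ?B \<longleftrightarrow> \<gamma> \<in> ?B"
    using boundaries_scale[of \<gamma> j S "-1"] boundaries_scale[of "\<lambda>\<sigma>. - \<gamma> \<sigma>" j S "-1"] by auto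
  finally show ?thesis using card_boundaries_pos[OF finS, where ?'k = "'p mod_ring"]
    by (simp add: field_simps)
qed

section \<open>Wilson loops in finite volume\<close>

text \<open>
  The common law of both models on sets \<open>S\<close> of \<open>(j + 1)\<close>-cells, up to normalization; \<open>x\<close> is the odds
  \<open>p / (1 - p)\<close> of a cell.
\<close>

definition boundary_weight :: "'k::field itself \<Rightarrow> nat \<Rightarrow> real \<Rightarrow> cube set \<Rightarrow> real" where
  "boundary_weight F j x S = x ^ card S / real (card (boundaries j S :: 'k chain set))"

text \<open>
  A cell contributes the factor \<open>exp \<beta> = (exp \<beta> - 1) + 1\<close> if \<open>f\<close> is closed there and \<open>1\<close> if not. In the
  expanded product, \<open>S\<close> is the set of cells where the first summand is taken, as in the Edwards--Sokal coupling.
\<close>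

lemma exp_hamiltonian:
  fixes f :: "cube \<Rightarrow> 'k::field"
  assumes "finite X"
  shows "exp (- \<beta> * hamiltonian i X f) =
    (\<Sum>S\<in>Pow (cells i X). (exp \<beta> - 1) ^ card S * of_bool (\<forall>\<sigma>\<in>S. coboundary f \<sigma> = 0))"
proof -
  let ?E = "cells i X" and ?o = "\<lambda>\<sigma>. of_bool (coboundary f \<sigma> = 0) :: real"
  have fin: "finite ?E" using assms by (simp add: cells_def)
  have "exp (- \<beta> * hamiltonian i X f) = (\<Prod>\<sigma>\<in>?E. exp (\<beta> * ?o \<sigma>))"
    unfolding hamiltonian_def minus_mult_minus sum_distrib_left exp_sum[OF fin] ..
  also have "\<dots> = (\<Prod>\<sigma>\<in>?E. (exp \<beta> - 1) * ?o \<sigma> + 1)"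
    by (intro prod.cong) auto
  also have "\<dots> = (\<Sum>S\<in>Pow ?E. (\<Prod>\<sigma>\<in>S. (exp \<beta> - 1) * ?o \<sigma>) * (\<Prod>\<sigma>\<in>?E - S. 1))"
    using fin by (rule prod_add)
  also have "\<dots> = (\<Sum>S\<in>Pow ?E. (exp \<beta> - 1) ^ card S * of_bool (\<forall>\<sigma>\<in>S. coboundary f \<sigma> = 0))"
  proof (intro sum.cong refl)
    fix S assume "S \<in> Pow ?E"
    then have "finite S" using fin finite_subset by auto
    then have "(\<Prod>\<sigma>\<in>S. ?o \<sigma>) = of_bool (\<forall>\<sigma>\<in>S. coboundary f \<sigma> = 0)" by (induction S) auto
    then show "(\<Prod>\<sigma>\<in>S. (exp \<beta> - 1) * ?o \<sigma>) * (\<Prod>\<sigma>\<in>?E - S. 1)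
        = (exp \<beta> - 1) ^ card S * of_bool (\<forall>\<sigma>\<in>S. coboundary f \<sigma> = 0)"
      by (simp add: prod.distrib)
  qed
  finally show ?thesis .
qed

lemma sum_exp_hamiltonian_wilson:
  fixes \<gamma> :: "('p::prime_card) mod_ring chain"
  assumes X: "finite X" "face_closed X" and \<gamma>: "\<gamma> \<in> cell_chains j X"
  shows "(\<Sum>f\<in>cochains j X. of_real (exp (- \<beta> * hamiltonian (Suc j) X f)) * wilson \<gamma> f)
    = of_real (real (card (cochains j X :: 'p mod_ring chain set)) *
        (\<Sum>S\<in>Pow (cells (Suc j) X). of_bool (\<gamma> \<in> boundaries j S) *
           boundary_weight TYPE('p mod_ring) j (exp \<beta> - 1) S))"
proof -
  let ?C = "cochains j X :: 'p mod_ring chain set" and ?E = "cells (Suc j) X"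
  let ?x = "exp \<beta> - 1"
  have "(\<Sum>f\<in>?C. of_real (exp (- \<beta> * hamiltonian (Suc j) X f)) * wilson \<gamma> f)
    = (\<Sum>f\<in>?C. \<Sum>S\<in>Pow ?E. of_real (?x ^ card S) * (of_bool (\<forall>\<sigma>\<in>S. coboundary f \<sigma> = 0) * wilson \<gamma> f))"
    unfolding exp_hamiltonian[OF X(1)] of_real_sum sum_distrib_right
    by (intro sum.cong refl) (simp add: mult.assoc)
  also have "\<dots> = (\<Sum>S\<in>Pow ?E. of_real (?x ^ card S) *
      (\<Sum>f\<in>?C. of_bool (\<forall>\<sigma>\<in>S. coboundary f \<sigma> = 0) * wilson \<gamma> f))"
    unfolding sum_distrib_left by (rule sum.swap)
  also have "\<dots> = (\<Sum>S\<in>Pow ?E. of_real (real (card ?C) * (of_bool (\<gamma> \<in> boundaries j S) *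
           boundary_weight TYPE('p mod_ring) j ?x S)))"
    by (intro sum.cong refl, subst sum_wilson_cocycles[OF X _ \<gamma>])
       (auto simp: boundary_weight_def)
  finally show ?thesis by (simp add: sum_distrib_left)
qed

lemma wilson_zero [simp]: "wilson (\<lambda>_. 0) f = 1"
  by (simp add: wilson_def evaluate_def)

theorem expectation_wilson_potts_gauge:
  fixes \<gamma> :: "('p::prime_card) mod_ring chain" and \<beta> :: real
  assumes X: "finite X" "face_closed X" and \<gamma>: "\<gamma> \<in> cell_chains j X"
  defines "w \<equiv> boundary_weight TYPE('p mod_ring) j (exp \<beta> - 1)"
  shows "(\<integral>f. wilson \<gamma> f \<partial>potts_gauge (Suc j) \<beta> X) =
    of_real ((\<Sum>S\<in>Pow (cells (Suc j) X). of_bool (\<gamma> \<in> boundaries j S) * w S) / (\<Sum>S\<in>Pow (cells (Suc j) X). w S))"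
proof -
  let ?C = "cochains j X :: 'p mod_ring chain set" and ?E = "cells (Suc j) X"
  let ?h = "\<lambda>f :: 'p mod_ring chain. exp (- \<beta> * hamiltonian (Suc j) X f)"
  \<comment> \<open>The zero chain has Wilson loop variable 1 and is always a boundary, so its case is the partition function.\<close>
  have "complex_of_real (\<Sum>f\<in>?C. ?h f) = of_real (real (card ?C) * (\<Sum>S\<in>Pow ?E. w S))"
    using sum_exp_hamiltonian_wilson[OF X zero_chains, of \<beta>] by (simp add: zero_boundaries w_def)
  then have Z: "(\<Sum>f\<in>?C. ?h f) = real (card ?C) * (\<Sum>S\<in>Pow ?E. w S)"
    by (simp only: of_real_eq_iff)
  have "(\<lambda>_. 0) \<in> ?C" by (simp add: cochains_def)
  then have C: "card ?C \<noteq> 0" using finite_cochains[OF X(1)] by (metis card_eq_0_iff empty_iff)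
  have "(\<integral>f. wilson \<gamma> f \<partial>potts_gauge (Suc j) \<beta> X)
      = (\<Sum>f\<in>?C. pmf (potts_gauge (Suc j) \<beta> X) f *\<^sub>R wilson \<gamma> f)"
    using finite_cochains[OF X(1)]
    by (intro integral_measure_pmf) (auto simp: set_pmf_eq pmf_potts_gauge[OF X(1)] split: if_splits)
  also have "\<dots> = (\<Sum>f\<in>?C. of_real (?h f) * wilson \<gamma> f) / of_real (\<Sum>f\<in>?C. ?h f)"
    unfolding sum_divide_distrib
    by (intro sum.cong refl) (simp add: pmf_potts_gauge[OF X(1)] scaleR_conv_of_real)
  also have "\<dots> = of_real ((\<Sum>S\<in>Pow ?E. of_bool (\<gamma> \<in> boundaries j S) * w S) / (\<Sum>S\<in>Pow ?E. w S))"
    unfolding sum_exp_hamiltonian_wilson[OF X \<gamma>] Z w_def using C by simp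
  finally show ?thesis .
qed

section \<open>Null-homology in the finite random-cluster model\<close>

lemma prc_configs_eq:
  "prc_configs i X = (\<lambda>S. {\<sigma> \<in> X. cube_dim \<sigma> < i} \<union> S) ` Pow (cells i X)"
proof
  show "prc_configs i X \<subseteq> (\<lambda>S. {\<sigma> \<in> X. cube_dim \<sigma> < i} \<union> S) ` Pow (cells i X)"
  proof
    fix P assume P: "P \<in> prc_configs i X"
    then have "P = {\<sigma> \<in> X. cube_dim \<sigma> < i} \<union> cells i P" "cells i P \<subseteq> cells i X"
      by (auto simp: prc_configs_def cells_def order_less_le)
    then show "P \<in> (\<lambda>S. {\<sigma> \<in> X. cube_dim \<sigma> < i} \<union> S) ` Pow (cells i X)" by blast
  qed
qed (auto simp: prc_configs_def cells_def)

text \<open>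
  A configuration \<open>P\<close> has the same \<open>j\<close>-cycles as \<open>X\<close>, because it contains every cell of \<open>X\<close> of dimension at most
  \<open>j\<close>. So its Betti number depends on \<open>P\<close> only through the number of boundaries.
\<close>

lemma prc_weight_eq:
  fixes X :: "cube set"
  assumes X: "finite X" "face_closed X" and p: "0 \<le> p" "p < 1" and P: "P \<in> prc_configs (Suc j) X"
  shows "prc_weight TYPE('k::{finite,field}) (Suc j) p (real CARD('k)) X P =
    (1 - p) ^ card (cells (Suc j) X) * real (card (cycles j X :: 'k chain set)) *
      boundary_weight TYPE('k) j (p / (1 - p)) (cells (Suc j) P)"
proof -
  have PX: "P \<subseteq> X" using P by (simp add: prc_configs_def)
  then have finP: "finite P" using X finite_subset by blast
  have "face_closed P"
    unfolding face_closed_def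
  proof (intro ballI allI impI)
    fix \<sigma> k a assume \<sigma>: "\<sigma> \<in> P" "k < length \<sigma>" "\<sigma> ! k = Edge a"
    then have "cube_dim \<sigma> \<le> Suc j" using P by (auto simp: prc_configs_def)
    then have "cube_dim (\<sigma>[k := Pt b]) < Suc j" for b using cube_dim_face[OF \<sigma>(2,3), of b] by simp
    moreover have "\<sigma>[k := Pt a] \<in> X \<and> \<sigma>[k := Pt (a + 1)] \<in> X"
      using X(2) \<sigma> PX by (auto simp: face_closed_def)
    ultimately show "\<sigma>[k := Pt a] \<in> P \<and> \<sigma>[k := Pt (a + 1)] \<in> P"
      using P by (auto simp: prc_configs_def)
  qed
  moreover have "cells j P = cells j X" using P by (auto simp: prc_configs_def cells_def)
  then have "cycles j P = (cycles j X :: 'k chain set)" by (simp add: cycles_def cell_chains_def)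
  ultimately have "real (card (cycles j X :: 'k chain set))
      = real CARD('k) ^ betti TYPE('k) j P * real (card (boundaries j (cells (Suc j) P) :: 'k chain set))"
    using card_cycles[OF finP, where ?'k = 'k and j = j] by (simp add: boundaries_cells)
  then have betti: "real CARD('k) ^ betti TYPE('k) j P
      = real (card (cycles j X :: 'k chain set)) / real (card (boundaries j (cells (Suc j) P) :: 'k chain set))"
    using card_boundaries_pos[OF finP, where ?'k = 'k and j = j] by (simp add: boundaries_cells)
  have "cells (Suc j) P \<subseteq> cells (Suc j) X" using PX by (auto simp: cells_def)
  then have "card (cells (Suc j) P) \<le> card (cells (Suc j) X)"
    using X(1) by (intro card_mono) (auto simp: cells_def)
  then have "(1 - p) ^ card (cells (Suc j) X)
      = (1 - p) ^ (card (cells (Suc j) X) - card (cells (Suc j) P)) * (1 - p) ^ card (cells (Suc j) P)"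
    by (simp flip: power_add)
  then show ?thesis
    using p by (simp add: prc_weight_def boundary_weight_def betti power_divide)
qed

text \<open>
  A configuration is determined by its cells of top dimension, so the constant factor of the previous lemma
  cancels against the normalization.
\<close>

theorem prob_prc_model:
  fixes X :: "cube set" and j :: nat
  assumes X: "finite X" "face_closed X" and p: "0 \<le> p" "p < 1"
  defines "w \<equiv> boundary_weight TYPE('k::{finite,field}) j (p / (1 - p))"
  shows "measure_pmf.prob (prc_model TYPE('k) (Suc j) p (real CARD('k)) X) {P. Q (cells (Suc j) P)} =
    (\<Sum>S\<in>Pow (cells (Suc j) X). of_bool (Q S) * w S) / (\<Sum>S\<in>Pow (cells (Suc j) X). w S)"
proof -
  let ?E = "cells (Suc j) X" and ?q = "real CARD('k)"
  let ?M = "prc_model TYPE('k) (Suc j) p ?q X" and ?W = "prc_weight TYPE('k) (Suc j) p ?q X"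
  let ?P = "prc_configs (Suc j) X" and ?up = "\<lambda>S. {\<sigma> \<in> X. cube_dim \<sigma> < Suc j} \<union> S"
  define c where "c = (1 - p) ^ card ?E * real (card (cycles j X :: 'k chain set))"
  have "finite (cycles j X :: 'k chain set)"
    using finite_cell_chains[OF X(1)] by (rule finite_subset[rotated]) (auto simp: cycles_def)
  then have "card (cycles j X :: 'k chain set) \<noteq> 0" using zero_cycles by (metis card_eq_0_iff empty_iff)
  then have c: "c \<noteq> 0" using p by (simp add: c_def)
  have cells_up: "cells (Suc j) (?up S) = S" if "S \<subseteq> ?E" for S using that by (auto simp: cells_def)
  have sum_configs: "(\<Sum>P\<in>?P. h (cells (Suc j) P) * ?W P) = c * (\<Sum>S\<in>Pow ?E. h S * w S)" for h
  proof -
    have "(\<Sum>P\<in>?P. h (cells (Suc j) P) * ?W P) = (\<Sum>P\<in>?P. h (cells (Suc j) P) * (c * w (cells (Suc j) P)))"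
      using prc_weight_eq[OF X p, where ?'k = 'k and j = j] by (simp add: c_def w_def)
    also have "\<dots> = (\<Sum>S\<in>Pow ?E. h S * (c * w S))"
      unfolding prc_configs_eq
    proof (subst sum.reindex)
      show "inj_on ?up (Pow ?E)" by (rule inj_on_inverseI[where g = "cells (Suc j)"]) (use cells_up in auto)
    qed (auto intro!: sum.cong simp: cells_up)
    finally show ?thesis by (simp add: sum_distrib_left mult_ac)
  qed
  have finP: "finite ?P" using X(1) by (simp add: prc_configs_eq cells_def)
  have "measure_pmf.prob ?M {P. Q (cells (Suc j) P)} = (\<integral>P. indicator {P. Q (cells (Suc j) P)} P \<partial>?M)"
    by simp
  also have "\<dots> = (\<Sum>P\<in>?P. pmf ?M P *\<^sub>R indicator {P. Q (cells (Suc j) P)} P)"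
    using finP p by (intro integral_measure_pmf)
      (auto simp: set_pmf_eq pmf_prc_model[OF X(1)] split: if_splits)
  also have "\<dots> = (\<Sum>P\<in>?P. of_bool (Q (cells (Suc j) P)) * ?W P) / (\<Sum>P\<in>?P. ?W P)"
    unfolding sum_divide_distrib using p
    by (intro sum.cong refl) (simp add: pmf_prc_model[OF X(1)] indicator_def)
  also have "\<dots> = (\<Sum>S\<in>Pow ?E. of_bool (Q S) * w S) / (\<Sum>S\<in>Pow ?E. w S)"
    using sum_configs[of "\<lambda>S. of_bool (Q S)"] sum_configs[of "\<lambda>_. 1"] c by simp
  finally show ?thesis .
qed

section \<open>Weak limits of local observables\<close>

lemma topspace_config [simp]: "topspace config_topology = UNIV"
  by (simp add: config_topology_def)

text \<open>
  Cylinder sets over finitely many plaquettes are open, hence so is any set that is decided by finitely many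
  plaquettes. Since its complement is decided by them too, such a set has a continuous indicator function.
\<close>

lemma openin_config_if_local:
  assumes F: "finite F" and loc: "\<And>\<omega> \<omega>'. \<lbrakk>\<omega> \<in> A; \<forall>\<sigma>\<in>F. \<omega>' \<sigma> = \<omega> \<sigma>\<rbrakk> \<Longrightarrow> \<omega>' \<in> A"
  shows "openin config_topology (A :: (cube \<Rightarrow> 's) set)"
proof (subst openin_subopen, intro ballI)
  fix \<omega> assume \<omega>: "\<omega> \<in> A"
  let ?U = "\<lambda>\<sigma>. if \<sigma> \<in> F then {\<omega> \<sigma>} else UNIV"
  have "{\<sigma>. ?U \<sigma> \<noteq> UNIV} \<subseteq> F" by auto
  then have "finite {\<sigma>. ?U \<sigma> \<noteq> UNIV}" using F finite_subset by blast
  then have op: "openin config_topology (PiE UNIV ?U)"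
    unfolding config_topology_def by (intro product_topology_basis) simp_all
  have mem: "\<omega> \<in> PiE UNIV ?U" by (simp add: PiE_iff)
  have sub: "PiE UNIV ?U \<subseteq> A"
  proof
    fix \<omega>' assume "\<omega>' \<in> PiE UNIV ?U"
    then have U: "\<omega>' \<sigma> \<in> ?U \<sigma>" for \<sigma> by (simp only: PiE_iff UNIV_I)
    have "\<forall>\<sigma>\<in>F. \<omega>' \<sigma> = \<omega> \<sigma>"
    proof
      show "\<omega>' \<sigma> = \<omega> \<sigma>" if "\<sigma> \<in> F" for \<sigma> using U[of \<sigma>] that by simp
    qed
    then show "\<omega>' \<in> A" by (rule loc[OF \<omega>])
  qed
  show "\<exists>T. openin config_topology T \<and> \<omega> \<in> T \<and> T \<subseteq> A"
    by (intro exI[of _ "PiE UNIV ?U"] conjI op mem sub)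
qed

lemma continuous_map_config_if_local:
  fixes g :: "(cube \<Rightarrow> 's) \<Rightarrow> real"
  assumes "finite F" and loc: "\<And>\<omega> \<omega>'. \<forall>\<sigma>\<in>F. \<omega>' \<sigma> = \<omega> \<sigma> \<Longrightarrow> g \<omega>' = g \<omega>"
  shows "continuous_map config_topology euclideanreal g"
proof -
  have "openin config_topology {\<omega>. g \<omega> \<in> U}" for U
    using assms(1)
  proof (rule openin_config_if_local)
    fix \<omega> \<omega>' assume "\<omega> \<in> {\<omega>. g \<omega> \<in> U}" "\<forall>\<sigma>\<in>F. \<omega>' \<sigma> = \<omega> \<sigma>"
    then show "\<omega>' \<in> {\<omega>. g \<omega> \<in> U}" using loc[of \<omega>' \<omega>] by simp
  qed
  then show ?thesis by (simp add: continuous_map_def)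
qed

lemma weak_limit_local:
  fixes g :: "(cube \<Rightarrow> 's) \<Rightarrow> real"
  assumes lim: "weak_limit M N" and F: "finite F"
    and loc: "\<And>\<omega> \<omega>'. \<forall>\<sigma>\<in>F. \<omega>' \<sigma> = \<omega> \<sigma> \<Longrightarrow> g \<omega>' = g \<omega>" and bound: "bounded (range g)"
  shows "(\<lambda>n. measure_pmf.expectation (M n) g) \<longlonglongrightarrow> (\<integral>x. g x \<partial>N)"
proof -
  have "continuous_map config_topology euclideanreal g"
    using F loc by (rule continuous_map_config_if_local)
  then show ?thesis using lim bound by (simp add: weak_limit_def)
qed

lemma weak_limit_local_sets:
  fixes A :: "(cube \<Rightarrow> 's) set"
  assumes lim: "weak_limit M N" and F: "finite F"
    and loc: "\<And>\<omega> \<omega>'. \<forall>\<sigma>\<in>F. \<omega>' \<sigma> = \<omega> \<sigma> \<Longrightarrow> \<omega>' \<in> A \<longleftrightarrow> \<omega> \<in> A"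
  shows "A \<in> sets N"
proof -
  have "openin config_topology A"
    using F
  proof (rule openin_config_if_local)
    show "\<omega>' \<in> A" if "\<omega> \<in> A" "\<forall>\<sigma>\<in>F. \<omega>' \<sigma> = \<omega> \<sigma>" for \<omega> \<omega>'
      using loc[OF that(2)] that(1) by simp
  qed
  moreover have "sets N = sigma_sets UNIV {U. openin config_topology U}"
    using lim by (simp add: weak_limit_def)
  ultimately show ?thesis by (simp add: sigma_sets.Basic)
qed

lemma weak_limit_prob_local:
  fixes A :: "(cube \<Rightarrow> 's) set"
  assumes lim: "weak_limit M N" and F: "finite F"
    and loc: "\<And>\<omega> \<omega>'. \<forall>\<sigma>\<in>F. \<omega>' \<sigma> = \<omega> \<sigma> \<Longrightarrow> \<omega>' \<in> A \<longleftrightarrow> \<omega> \<in> A"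
  shows "(\<lambda>n. measure_pmf.prob (M n) A) \<longlonglongrightarrow> measure N A"
proof -
  have ind: "indicator A \<omega>' = (indicator A \<omega> :: real)" if "\<forall>\<sigma>\<in>F. \<omega>' \<sigma> = \<omega> \<sigma>" for \<omega> \<omega>'
    using loc[OF that] by (simp add: indicator_def)
  have bound: "bounded (range (indicator A :: _ \<Rightarrow> real))"
    by (rule boundedI[where B = 1]) (auto simp: indicator_def)
  have "(\<lambda>n. measure_pmf.expectation (M n) (indicator A)) \<longlonglongrightarrow> (\<integral>x. indicator A x \<partial>N :: real)"
    by (rule weak_limit_local[where g = "indicator A", OF lim F ind bound])
  moreover have "space N = UNIV" using lim by (simp add: weak_limit_def)
  ultimately show ?thesis by simp
qed

text \<open>
  Weak convergence speaks about real observables, so real and imaginary part are treated separately.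
\<close>

lemma weak_limit_wilson:
  fixes \<gamma> :: "('p::prime_card) mod_ring chain"
  assumes lim: "weak_limit M N" and \<gamma>: "finite {\<sigma>. \<gamma> \<sigma> \<noteq> 0}"
  shows "(\<lambda>n. \<integral>f. wilson \<gamma> f \<partial>measure_pmf (M n)) \<longlonglongrightarrow> (\<integral>f. wilson \<gamma> f \<partial>N)"
proof -
  interpret N: prob_space N using lim by (simp add: weak_limit_def)
  have loc: "wilson \<gamma> f' = wilson \<gamma> f" if "\<forall>\<sigma>\<in>{\<sigma>. \<gamma> \<sigma> \<noteq> 0}. f' \<sigma> = f \<sigma>" for f f'
    using that by (auto simp: wilson_def evaluate_def intro!: arg_cong[where f = root_of_unity] sum.cong)
  have norm: "norm (wilson \<gamma> f) = 1" for f by (simp add: wilson_def)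
  have "wilson \<gamma> \<in> borel_measurable N"
  proof (rule borel_measurableI)
    fix S :: "complex set"
    have "wilson \<gamma> -` S \<in> sets N" 
    proof (rule weak_limit_local_sets[OF lim \<gamma>])
      show "f' \<in> wilson \<gamma> -` S \<longleftrightarrow> f \<in> wilson \<gamma> -` S" if "\<forall>\<sigma>\<in>{\<sigma>. \<gamma> \<sigma> \<noteq> 0}. f' \<sigma> = f \<sigma>" for f f'
        using loc[OF that] by simp
    qed
    moreover have "space N = UNIV" using lim by (simp add: weak_limit_def)
    ultimately show "wilson \<gamma> -` S \<inter> space N \<in> sets N" by simp
  qed
  then have int: "integrable N (wilson \<gamma>)"
    by (intro N.integrable_const_bound[where B = 1]) (auto simp: norm)
  have int': "integrable (measure_pmf (M n)) (wilson \<gamma>)" for n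
    by (intro measure_pmf.integrable_const_bound[where B = 1]) (auto simp: norm)
  have Re: "bounded (range (\<lambda>f. Re (wilson \<gamma> f)))"
  proof (rule boundedI, clarify)
    show "norm (Re (wilson \<gamma> f)) \<le> 1" for f using abs_Re_le_cmod[of "wilson \<gamma> f"] by (simp add: norm)
  qed
  have Im: "bounded (range (\<lambda>f. Im (wilson \<gamma> f)))"
  proof (rule boundedI, clarify)
    show "norm (Im (wilson \<gamma> f)) \<le> 1" for f using abs_Im_le_cmod[of "wilson \<gamma> f"] by (simp add: norm)
  qed
  have "(\<lambda>n. \<integral>f. Re (wilson \<gamma> f) \<partial>measure_pmf (M n)) \<longlonglongrightarrow> (\<integral>f. Re (wilson \<gamma> f) \<partial>N)"
    "(\<lambda>n. \<integral>f. Im (wilson \<gamma> f) \<partial>measure_pmf (M n)) \<longlonglongrightarrow> (\<integral>f. Im (wilson \<gamma> f) \<partial>N)"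
    by (rule weak_limit_local[OF lim \<gamma> _ Re] weak_limit_local[OF lim \<gamma> _ Im], simp only: loc)+
  then show ?thesis
    by (simp add: tendsto_complex_iff int int' flip: integral_Re integral_Im)
qed

section \<open>Null-homology and boxes\<close>

lemma null_homologous_mono: "null_homologous i \<gamma> S \<Longrightarrow> S \<subseteq> T \<Longrightarrow> null_homologous i \<gamma> T"
  unfolding null_homologous_def cell_chains_def cells_def by blast

lemma null_homologous_finite_subset:
  assumes "null_homologous i \<gamma> S"
  obtains F where "finite F" "null_homologous i \<gamma> (S \<inter> F)"
proof -
  obtain \<rho> where \<rho>: "\<rho> \<in> cell_chains i S" "\<gamma> = boundary \<rho>"
    using assms by (auto simp: null_homologous_def)
  let ?F = "{\<sigma>. \<rho> \<sigma> \<noteq> 0}"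
  have "\<rho> \<in> cell_chains i (S \<inter> ?F)" using \<rho>(1) by (auto simp: cell_chains_def cells_def)
  then have "null_homologous i \<gamma> (S \<inter> ?F)" using \<rho>(2) by (auto simp: null_homologous_def)
  then show ?thesis using \<rho>(1) that by (auto simp: cell_chains_def)
qed

lemma null_homologous_iff: "null_homologous (Suc j) \<gamma> S \<longleftrightarrow> \<gamma> \<in> boundaries j S"
  by (auto simp: null_homologous_def boundaries_def)

lemma null_homologous_cells: "null_homologous i \<gamma> (cells i S) \<longleftrightarrow> null_homologous i \<gamma> S"
  by (simp add: null_homologous_def cell_chains_cells)

lemma face_closed_box: "face_closed (box d n)"
  unfolding face_closed_def
proof (intro ballI allI impI)
  fix \<sigma> k a assume \<sigma>: "\<sigma> \<in> box d n" "k < length \<sigma>" "\<sigma> ! k = Edge a"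
  then have "Edge a \<in> set \<sigma>" by (metis nth_mem)
  then have a: "{a, a + 1} \<subseteq> {- int n..int n}" using \<sigma>(1) by (force simp: box_def)
  have "\<sigma>[k := Pt b] \<in> box d n" if "b \<in> {a, a + 1}" for b
  proof -
    have "endpoints I \<subseteq> {- int n..int n}" if "I \<in> set (\<sigma>[k := Pt b])" for I
    proof -
      have "I = Pt b \<or> I \<in> set \<sigma>" using that set_update_subset_insert[of \<sigma> k "Pt b"] by blast
      then show ?thesis using a \<open>b \<in> {a, a + 1}\<close> \<sigma>(1) by (auto simp: box_def)
    qed
    then show ?thesis using \<sigma>(1) by (auto simp: box_def lattice_complex_def)
  qed
  then show "\<sigma>[k := Pt a] \<in> box d n \<and> \<sigma>[k := Pt (a + 1)] \<in> box d n" by simp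
qed

lemma box_mono: "m \<le> n \<Longrightarrow> box d m \<subseteq> box d n"
  unfolding box_def by fastforce

lemma finite_subset_box:
  assumes "finite F" "F \<subseteq> lattice_complex d"
  obtains n where "F \<subseteq> box d n"
proof -
  have "\<exists>n. \<sigma> \<in> box d n" if "\<sigma> \<in> F" for \<sigma>
  proof -
    let ?n = "Max (insert 0 ((\<lambda>x. nat \<bar>x\<bar>) ` \<Union> (endpoints ` set \<sigma>)))"
    have fin: "finite (\<Union> (endpoints ` set \<sigma>))"
    proof (intro finite_UN_I finite_set)
      show "finite (endpoints I)" for I by (cases I) auto
    qed
    have "nat \<bar>x\<bar> \<le> ?n" if "I \<in> set \<sigma>" "x \<in> endpoints I" for I x
      using fin that by (intro Max_ge) auto
    then have "endpoints I \<subseteq> {- int ?n..int ?n}" if "I \<in> set \<sigma>" for I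
      using that by fastforce
    then have "\<sigma> \<in> box d ?n" using that assms(2) by (auto simp: box_def)
    then show ?thesis ..
  qed
  then obtain n where n: "\<sigma> \<in> box d (n \<sigma>)" if "\<sigma> \<in> F" for \<sigma> by metis
  have "F \<subseteq> box d (Max (n ` F))"
  proof
    fix \<sigma> assume "\<sigma> \<in> F"
    then show "\<sigma> \<in> box d (Max (n ` F))" using n box_mono[of "n \<sigma>" "Max (n ` F)"] assms(1) by auto
  qed
  then show ?thesis by (rule that)
qed

section \<open>Monotonicity in the volume\<close>

text \<open>
  The power of \<open>x\<close> is modular, so everything rests on the numbers of boundaries.
\<close>

lemma boundary_weight_lattice:
  assumes "finite S" "finite T" "0 \<le> x"
  shows "boundary_weight TYPE('k::{finite,field}) j x S * boundary_weight TYPE('k) j x T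
    \<le> boundary_weight TYPE('k) j x (S \<inter> T) * boundary_weight TYPE('k) j x (S \<union> T)"
proof -
  let ?b = "\<lambda>S. real (card (boundaries j S :: 'k chain set))"
  have pos: "?b (S \<union> T) > 0" "?b (S \<inter> T) > 0" "?b S > 0" "?b T > 0"
    using assms by (simp_all add: card_boundaries_pos)
  have "card S + card T = card (S \<inter> T) + card (S \<union> T)"
    using card_Un_Int[OF assms(1,2)] by simp
  then have x: "x ^ card S * x ^ card T = x ^ card (S \<inter> T) * x ^ card (S \<union> T)"
    by (simp flip: power_add)
  have le: "?b (S \<inter> T) * ?b (S \<union> T) \<le> ?b S * ?b T"
    using card_boundaries_lattice[OF assms(1,2), of j, where ?'k = 'k]
    by (simp add: mult.commute flip: of_nat_mult)
  have "x ^ card S * x ^ card T / (?b S * ?b T) \<le> x ^ card S * x ^ card T / (?b (S \<inter> T) * ?b (S \<union> T))"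
    using le pos assms(3) by (intro divide_left_mono mult_pos_pos mult_nonneg_nonneg) auto
  then show ?thesis by (simp add: boundary_weight_def x)
qed

lemma sum_boundary_weight_pos:
  assumes "finite E" "0 \<le> x"
  shows "(\<Sum>S\<in>Pow E. boundary_weight TYPE('k::{finite,field}) j x S) > 0"
  using assms by (intro sum_pos2[where i = "{}"]) (auto simp: boundary_weight_def card_boundaries_pos)

text \<open>
  The model on \<open>X\<close> is the model on \<open>Y\<close> conditioned on having no top-dimensional cells outside \<open>X\<close>, since \<open>boundary_weight\<close>
  does not refer to the ambient complex. By positive association, lifting this condition favours the increasing event.
\<close>

lemma prob_prc_model_mono:
  fixes \<gamma> :: "'k::{finite,field} chain"
  assumes X: "finite X" "face_closed X" and Y: "finite Y" "face_closed Y" and XY: "X \<subseteq> Y"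
    and p: "0 \<le> p" "p < 1"
  shows "measure_pmf.prob (prc_model TYPE('k) (Suc j) p (real CARD('k)) X) {P. null_homologous (Suc j) \<gamma> P}
    \<le> measure_pmf.prob (prc_model TYPE('k) (Suc j) p (real CARD('k)) Y) {P. null_homologous (Suc j) \<gamma> (P \<inter> X)}"
proof -
  let ?w = "boundary_weight TYPE('k) j (p / (1 - p))" and ?Q = "null_homologous (Suc j) \<gamma>"
  let ?E = "\<lambda>X. cells (Suc j) X"
  have x: "0 \<le> p / (1 - p)" using p by simp
  have E: "finite (?E X)" "finite (?E Y)" "?E X \<subseteq> ?E Y" using X Y XY by (auto simp: cells_def)
  have "?E P \<inter> ?E X = ?E (P \<inter> X)" for P by (auto simp: cells_def)
  then have eq: "{P. ?Q P} = {P. ?Q (?E P)}" "{P. ?Q (P \<inter> X)} = {P. ?Q (?E P \<inter> ?E X)}"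
    by (simp_all add: null_homologous_cells)
  have "(\<Sum>S\<in>Pow (?E X). of_bool (?Q S) * ?w S) * (\<Sum>S\<in>Pow (?E Y). ?w S) \<le>
    (\<Sum>S\<in>Pow (?E X). ?w S) * (\<Sum>S\<in>Pow (?E Y). of_bool (?Q (S \<inter> ?E X)) * ?w S)"
  proof (rule increasing_event_mono)
    show "0 \<le> ?w S" for S using p by (simp add: boundary_weight_def)
    show "?w S * ?w T \<le> ?w (S \<inter> T) * ?w (S \<union> T)" if "S \<subseteq> ?E Y" "T \<subseteq> ?E Y" for S T
      using that E x by (intro boundary_weight_lattice) (auto intro: finite_subset)
  qed (use E in \<open>auto intro: null_homologous_mono\<close>)
  then show ?thesis
    unfolding eq prob_prc_model[OF X p] prob_prc_model[OF Y p, where Q = "\<lambda>S. ?Q (S \<inter> ?E X)"]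
    using sum_boundary_weight_pos[OF E(1) x, where ?'k = 'k and j = j]
      sum_boundary_weight_pos[OF E(2) x, where ?'k = 'k and j = j]
    by (simp add: field_simps)
qed

section \<open>Infinite volume\<close>

text \<open>
  Convergence on a non-local event. Let \<open>A F\<close> be the local event that \<open>\<gamma>\<close> bounds inside the finite set \<open>F\<close>. If \<open>u n\<close>
  denotes the probability in the box of radius \<open>n\<close> that \<open>\<gamma>\<close> is null-homologous, then \<open>u n\<close> is at most the probability of \<open>A (box d n)\<close> in any larger
  box, hence in the limit \<open>\<mu>\<close>. Conversely, for each \<open>F\<close> the probability of \<open>A F\<close> in the boxes is at most \<open>u n\<close>, so
  its limit is at most \<open>L\<close>, and the events \<open>A F\<close> exhaust \<open>V_event\<close>.
\<close>

theorem free_prc_model_V_event: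
  fixes \<gamma> :: "'k::{finite,field} chain"
  assumes \<mu>: "free_prc_model TYPE('k) d (Suc j) p (real CARD('k)) \<mu>" and p: "0 \<le> p" "p < 1"
    and v: "v \<longlonglongrightarrow> L"
    and v_eq: "\<forall>\<^sub>F n in sequentially. v n =
      measure_pmf.prob (prc_model TYPE('k) (Suc j) p (real CARD('k)) (box d n)) {P. null_homologous (Suc j) \<gamma> P}"
  shows "L = measure \<mu> (V_event (Suc j) \<gamma>)"
proof -
  let ?M = "\<lambda>n. prc_model TYPE('k) (Suc j) p (real CARD('k)) (box d n)"
  let ?Q = "null_homologous (Suc j) \<gamma>" and ?V = "V_event (Suc j) \<gamma>"
  let ?A = "\<lambda>F. {\<omega> :: cube \<Rightarrow> bool. ?Q ({\<sigma>. \<omega> \<sigma>} \<inter> F)}"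
  let ?u = "\<lambda>n. measure_pmf.prob (?M n) {P. ?Q P}"
  have lim: "weak_limit (\<lambda>n. map_pmf (\<lambda>P \<sigma>. \<sigma> \<in> P) (?M n)) \<mu>"
    using \<mu> by (simp add: free_prc_model_def)
  interpret prob_space \<mu> using lim by (simp add: weak_limit_def)
  have u: "?u \<longlonglongrightarrow> L" using v v_eq by (rule Lim_transform_eventually)
  have loc: "\<omega>' \<in> ?A F \<longleftrightarrow> \<omega> \<in> ?A F" if "\<forall>\<sigma>\<in>F. \<omega>' \<sigma> = \<omega> \<sigma>" for F \<omega> \<omega>'
  proof -
    have "{\<sigma>. \<omega>' \<sigma>} \<inter> F = {\<sigma>. \<omega> \<sigma>} \<inter> F" using that by auto
    then show ?thesis by simp
  qed
  have A_sets: "?A F \<in> sets \<mu>" if "finite F" for F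
    by (rule weak_limit_local_sets[OF lim that]) (rule loc)
  have A_lim: "(\<lambda>n. measure_pmf.prob (?M n) {P. ?Q (P \<inter> F)}) \<longlonglongrightarrow> measure \<mu> (?A F)" if "finite F" for F
  proof -
    have "(\<lambda>n. measure_pmf.prob (map_pmf (\<lambda>P \<sigma>. \<sigma> \<in> P) (?M n)) (?A F)) \<longlonglongrightarrow> measure \<mu> (?A F)"
      by (rule weak_limit_prob_local[OF lim that]) (rule loc)
    then show ?thesis by (simp add: vimage_def)
  qed
  have A_mono: "?A F \<subseteq> ?A G" if "F \<subseteq> G" for F G
  proof clarify
    fix \<omega> assume "?Q ({\<sigma>. \<omega> \<sigma>} \<inter> F)"
    then show "?Q ({\<sigma>. \<omega> \<sigma>} \<inter> G)" by (rule null_homologous_mono) (use that in blast)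
  qed
  have A_V: "?A F \<subseteq> ?V" for F
    unfolding V_event_def
  proof clarify
    fix \<omega> assume "?Q ({\<sigma>. \<omega> \<sigma>} \<inter> F)"
    then show "?Q {\<sigma>. \<omega> \<sigma>}" by (rule null_homologous_mono) blast
  qed
  \<comment> \<open>Configurations may contain plaquettes of any ambient dimension, so the exhaustion uses an enumeration of all plaquettes instead of boxes.\<close>
  define F where "F m = {\<sigma> :: cube. to_nat \<sigma> < m}" for m
  have finF: "finite (F m)" for m
  proof (rule finite_imageD)
    show "finite (to_nat ` F m)" by (rule finite_subset[of _ "{..<m}"]) (auto simp: F_def)
    show "inj_on to_nat (F m)" using inj_to_nat by (rule inj_on_subset) simp
  qed
  have V: "?V = (\<Union>m. ?A (F m))"
  proof
    show "?V \<subseteq> (\<Union>m. ?A (F m))"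
    proof
      fix \<omega> assume "\<omega> \<in> ?V"
      then have "?Q {\<sigma>. \<omega> \<sigma>}" by (simp add: V_event_def)
      then obtain G where G: "finite G" "?Q ({\<sigma>. \<omega> \<sigma>} \<inter> G)"
        by (rule null_homologous_finite_subset)
      have "finite (to_nat ` G)" using G(1) by simp
      then obtain m where "\<forall>k\<in>to_nat ` G. k < m" unfolding finite_nat_set_iff_bounded by blast
      then have "G \<subseteq> F m" by (auto simp: F_def)
      then have "\<omega> \<in> ?A (F m)" using G(2) A_mono by blast
      then show "\<omega> \<in> (\<Union>m. ?A (F m))" by blast
    qed
    show "(\<Union>m. ?A (F m)) \<subseteq> ?V" using A_V by blast
  qed
  have V_sets: "?V \<in> sets \<mu>" unfolding V using A_sets[OF finF] by blast
  have "L \<le> measure \<mu> ?V"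
  proof (rule LIMSEQ_le_const2[OF u], intro exI allI impI)
    fix n
    have "?u n \<le> measure_pmf.prob (?M N) {P. ?Q (P \<inter> box d n)}" if "n \<le> N" for N
      by (intro prob_prc_model_mono finite_box face_closed_box box_mono that p)
    then have "?u n \<le> measure \<mu> (?A (box d n))"
      by (intro LIMSEQ_le_const[OF A_lim[OF finite_box]]) blast
    also have "\<dots> \<le> measure \<mu> ?V"
      using A_V V_sets by (rule finite_measure_mono)
    finally show "?u n \<le> measure \<mu> ?V" .
  qed
  moreover have "measure \<mu> ?V \<le> L"
  proof (rule LIMSEQ_le_const2)
    show "(\<lambda>m. measure \<mu> (?A (F m))) \<longlonglongrightarrow> measure \<mu> ?V"
      unfolding V
    proof (rule finite_Lim_measure_incseq)
      show "range (\<lambda>m. ?A (F m)) \<subseteq> sets \<mu>" using A_sets[OF finF] by blast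
      show "incseq (\<lambda>m. ?A (F m))"
        unfolding incseq_def by (intro allI impI A_mono) (auto simp: F_def)
    qed
    have "measure \<mu> (?A (F m)) \<le> L" for m
    proof (rule LIMSEQ_le[OF A_lim[OF finF] u], intro exI allI impI)
      have "{P. ?Q (P \<inter> F m)} \<subseteq> {P. ?Q P}" using null_homologous_mono by blast
      then show "measure_pmf.prob (?M n) {P. ?Q (P \<inter> F m)} \<le> ?u n" for n
        by (rule measure_pmf.finite_measure_mono) simp
    qed
    then show "\<exists>N. \<forall>m\<ge>N. measure \<mu> (?A (F m)) \<le> L" by blast
  qed
  ultimately show ?thesis by simp
qed

theorem theorem5:
  fixes q d i :: nat
    and \<beta> :: real
    and \<gamma> :: "('p::prime_card) mod_ring chain"
    and \<nu> :: "(cube \<Rightarrow> 'p mod_ring) measure"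
    and \<mu> :: "(cube \<Rightarrow> bool) measure"
  assumes "q = CARD('p)"
    and "0 < i" and "i < d - 1"
    and "\<beta> \<ge> 0"
    and "\<gamma> \<in> cycles (i - 1) (lattice_complex d)"
    and "free_potts_gauge d i \<beta> \<nu>"
    and "free_prc_model TYPE('p mod_ring) d i (1 - exp (- \<beta>)) (real q) \<mu>"
  shows "(\<integral>f. wilson \<gamma> f \<partial>\<nu>) = complex_of_real (measure \<mu> (V_event i \<gamma>))"
proof -
  obtain j where i: "i = Suc j" using \<open>0 < i\<close> by (metis Suc_pred')
  define p where "p = 1 - exp (- \<beta>)"
  have p: "0 \<le> p" "p < 1" using \<open>\<beta> \<ge> 0\<close> by (simp_all add: p_def)
  have odds: "p / (1 - p) = exp \<beta> - 1" by (simp add: p_def field_simps flip: exp_add)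
  have q: "q = CARD('p mod_ring)" using assms(1) by simp
  let ?u = "\<lambda>n. measure_pmf.prob (prc_model TYPE('p mod_ring) (Suc j) p (real CARD('p mod_ring)) (box d n))
    {P. null_homologous (Suc j) \<gamma> P}"
  let ?W = "\<lambda>n. \<integral>f. wilson \<gamma> f \<partial>measure_pmf (potts_gauge i \<beta> (box d n))"
  have \<gamma>: "\<gamma> \<in> cell_chains j (lattice_complex d)" using assms(5) by (simp add: cycles_def i)
  then have fin: "finite {\<sigma>. \<gamma> \<sigma> \<noteq> 0}" and "{\<sigma>. \<gamma> \<sigma> \<noteq> 0} \<subseteq> lattice_complex d"
    by (auto simp: cell_chains_def cells_def)
  then obtain n0 where n0: "{\<sigma>. \<gamma> \<sigma> \<noteq> 0} \<subseteq> box d n0" by (rule finite_subset_box)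
  have W: "?W n = of_real (?u n)" if "n \<ge> n0" for n
  proof -
    have "\<gamma> \<in> cell_chains j (box d n)"
      using \<gamma> n0 box_mono[OF that] by (auto simp: cell_chains_def cells_def)
    then show ?thesis
      using prob_prc_model[OF finite_box face_closed_box p, where ?'k = "'p mod_ring" and j = j
          and Q = "null_homologous (Suc j) \<gamma>"]
      by (simp add: i expectation_wilson_potts_gauge finite_box face_closed_box odds null_homologous_cells
          null_homologous_iff)
  qed
  have lim: "?W \<longlonglongrightarrow> (\<integral>f. wilson \<gamma> f \<partial>\<nu>)"
    by (rule weak_limit_wilson[OF _ fin]) (use assms(6) in \<open>simp add: free_potts_gauge_def\<close>)
  have ev: "\<forall>\<^sub>F n in sequentially. Re (?W n) = ?u n" "\<forall>\<^sub>F n in sequentially. Im (?W n) = 0"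
    using W by (auto intro!: eventually_sequentiallyI[of n0])
  have "Re (\<integral>f. wilson \<gamma> f \<partial>\<nu>) = measure \<mu> (V_event i \<gamma>)"
    unfolding i
  proof (rule free_prc_model_V_event)
    show "free_prc_model TYPE('p mod_ring) d (Suc j) p (real CARD('p mod_ring)) \<mu>"
      using assms(7) by (simp add: i q p_def)
    show "(\<lambda>n. Re (?W n)) \<longlonglongrightarrow> Re (\<integral>f. wilson \<gamma> f \<partial>\<nu>)" by (rule tendsto_Re[OF lim])
  qed (use p ev(1) in auto)
  moreover have "Im (\<integral>f. wilson \<gamma> f \<partial>\<nu>) = 0"
    by (rule LIMSEQ_unique[OF Lim_transform_eventually[OF tendsto_Im[OF lim] ev(2)] tendsto_const])
  ultimately show ?thesis by (simp add: complex_eq_iff)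
qed

end
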